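(* Let $h\ge3$, $0\le n\le N$, and let $m_1,\dots,m_{h-1}$ be nonnegative integers with $m_1+\cdots+m_{h-1}=n$. Put $j_k=m_{k+1}+\cdots+m_{h-1}$ and, for nonnegative integers $n_2,\dots,n_h$ with $n_2+\cdots+n_h=n$, put $i_k=n_2+\cdots+n_{k-1}$. Then, as functions on $[h;N]$, $$\xi_{m_1,\dots,m_{h-1}}=\sum_{(n_2,\dots,n_h)}\left[\prod_{k=2}^{h-1}q^{-m_ki_k}\,r_{n_k}\bigl(m_k;\alpha_k,\,A_{k-1}q^{2i_k+k-2},\,A_{k-1}^{-1}A_hq^{n+j_k-i_k+h-k},\,n-i_k-j_k\,|\,q\bigr)\right]\theta_{n_2,\dots,n_h},$$ the sum being over nonnegative integers $n_2,\dots,n_h$ with $n_2+\cdots+n_h=n$ and $n_k\le n-i_k-j_k$ for $k=2,\dots,h-1$ (the connection coefficients with the remaining $\theta$'s are $0$). Moreover, for such $(n_2,\dots,n_h)$, these coefficients are, up to a factor not depending on $m_1,\dots,m_{h-1}$, the multidimensional $q$-Racah polynomials of Gasper and Rahman: with $s=h-2$, $y_k=m_1+\cdots+m_k$ for $1\le k\le h-1$, $b=\alpha_1$, $a_1=\alpha_2^{-1}\alpha_3^{-1}\cdots\alpha_h^{-1}q^{-2n-h+2}$ and $a_k=\alpha_kq$ for $k=2,\dots,h-1$, $$R_{(n_2,\dots,n_{h-1})}(y_1,\dots,y_{h-2};a_1,\dots,a_{h-1},b,n|q)=(-1)^{n_2+\cdots+n_{h-1}}\prod_{k=2}^{h-1}\frac{(A_kq^{2i_k+n_k+k-1};q)_{n_k}(\alpha_kq;q)_{n_k}(q;q)_{n_k}}{(A_{k-1}^{-1}A_hq^{n_k+h-k+1})^{n_k/2}}$$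 $$\qquad\times\prod_{k=2}^{h-1}q^{-m_ki_k}\,r_{n_k}\bigl(m_k;\alpha_k,\,A_{k-1}q^{2i_k+k-2},\,A_{k-1}^{-1}A_hq^{n+j_k-i_k+h-k},\,n-i_k-j_k\,|\,q\bigr).$$
   Context: Let $0<q<1$, let $h\ge3$ and $N\ge1$ be integers, and let $\alpha_1,\dots,\alpha_h$ be real numbers such that either $0<\alpha_i<q^{-1}$ for all $i$, or $\alpha_i>q^{-N}$ for all $i$. Write $(a;q)_k=\prod_{j=0}^{k-1}(1-aq^j)$. $[h;N]$ is the set of $\mathbf{x}=(x_1,\dots,x_h)$ with $x_i$ nonnegative integers and sum $N$. Put $X_k=x_1+\cdots+x_k$ ($X_0=0$), $A_k=\alpha_1\cdots\alpha_k$. One-variable $q$-Hahn polynomials: for $0\le n\le N'$, $0\le x\le N'$, $$Q_n(x;\alpha,\beta,N'|q)=q^{-nN'+n^2/2}\frac{(q;q)_{N'}}{(q;q)_{N'-n}}\sum_{k=0}^{n}\frac{(q^{-n};q)_k(\alpha\beta q^{n+1};q)_k(q^{-x};q)_k}{(\alpha q;q)_k(q^{-N'};q)_k(q;q)_k}\,q^k.$$ One-variable $q$-Racah polynomials: for $0\le n\le N'$, $0\le x\le N'$, $$r_n(x;\alpha,\beta,\delta,N'|q)=q^{-n(N'-n)}\frac{(\beta\delta q;q)_n(q^{N'-n+1};q)_n}{(\alpha\beta q^{n+1};q)_n(q;q)_n}\sum_{k=0}^{n}\frac{(q^{-n};q)_k(\delta q^{x-N'};q)_k(q^{-x};q)_k(\alpha\beta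 q^{n+1};q)_k}{(\alpha q;q)_k(\beta\delta q;q)_k(q^{-N'};q)_k(q;q)_k}\,q^k.$$ The Gasper–Rahman normalization (for $\delta>0$) is $$\widetilde r_n(x;\alpha,\beta,\delta,N'|q)=\frac{(-1)^n(\alpha\beta q^{n+1};q)_n(\alpha q;q)_n(q;q)_n}{(q^{-N'+n+1}\delta)^{n/2}}\,r_n(x;\alpha,\beta,\delta,N'|q).$$ The $q$-Hahn polynomials of the right-comb tree: with $j_k=m_{k+1}+\cdots+m_{h-1}$ for $0\le k\le h-1$, $$\xi_{m_1,\dots,m_{h-1}}(\mathbf{x})=\prod_{k=1}^{h-1}q^{-j_kx_k}\,Q_{m_k}\bigl(x_k;\,\alpha_k,\,A_hA_k^{-1}q^{h-k+2j_k-1},\,X_h-X_{k-1}-j_k\,|\,q\bigr)$$ when $x_k+\cdots+x_h\ge j_{k-1}$ for all $k=1,\dots,h-1$, and $\xi_{m_1,\dots,m_{h-1}}(\mathbf{x})=0$ otherwise. The $q$-Hahn polynomials of the left-comb tree: with $i_k=n_2+\cdots+n_{k-1}$ for $2\le k\le h+1$ ($i_2=0$), $$\theta_{n_2,\dots,n_h}(\mathbf{x})=\prod_{k=2}^{h}Q_{n_k}\bigl(X_{k-1}-i_k;\,A_{k-1}q^{k+2i_k-2},\,\alpha_k,\,X_k-i_k\,|\,q\bigr)$$ when $X_{k-1}\ge i_k$ for all $k=3,\dots,h+1$, and $\theta_{n_2,\dots,n_h}(\mathbf{x})=0$ otherwise. Gasper–Rahman multidimensional $q$-Racah polynomials: for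 $\mathbf{n}=(\nu_1,\dots,\nu_s)$, $N_k=\nu_1+\cdots+\nu_k$ ($N_0=0$), $\mathbf{y}=(y_1,\dots,y_s)$, $y_{s+1}=n$, $\widetilde A_k=a_1a_2\cdots a_k$, $$R_{\mathbf{n}}(\mathbf{y};a_1,\dots,a_{s+1},b,n|q)=\prod_{k=1}^s\widetilde r_{\nu_k}\bigl(y_{k+1}-y_k;\,a_{k+1}q^{-1},\,b\widetilde A_kq^{2N_{k-1}}a_1^{-1},\,\widetilde A_k^{-1}q^{-y_{k+1}-N_{k-1}},\,y_{k+1}-N_{k-1}\,|\,q\bigr).$$ *)

theory Defs
  imports Complex_Main "HOL-Library.FuncSet"
begin

definition qpoch :: "real \<Rightarrow> real \<Rightarrow> nat \<Rightarrow> real" where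
  "qpoch a q k = (\<Prod>j<k. 1 - a * q ^ j)"

text \<open>
  The tuples of nonnegative integers with sum \<open>n\<close>, indexed by \<open>I\<close>. The set \<open>[h;N]\<close> is
  \<open>compositions {1..h} N\<close>.
\<close>

definition compositions :: "nat set \<Rightarrow> nat \<Rightarrow> (nat \<Rightarrow> nat) set" where
  "compositions I n = {x \<in> I \<rightarrow>\<^sub>E UNIV. (\<Sum>i\<in>I. x i) = n}"

text \<open>
  In the one-variable polynomials, \<open>M\<close> is the parameter usually called \<open>N\<close>, and the arguments
  are meant to satisfy \<open>n \<le> M\<close> and \<open>x \<le> M\<close>. Integer exponents use \<open>powi\<close>; \<open>powr\<close> is
  used for the exponents that may be half-integers.
\<close>

definition q_hahn :: "real \<Rightarrow> nat \<Rightarrow> nat \<Rightarrow> real \<Rightarrow> real \<Rightarrow> nat \<Rightarrow> real" where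
  "q_hahn q n x \<alpha> \<beta> M =
     q powr (- (real n * real M) + (real n)\<^sup>2 / 2) * (qpoch q q M / qpoch q q (M - n)) *
     (\<Sum>k=0..n.
        (qpoch (q powi (- int n)) q k * qpoch (\<alpha> * \<beta> * q ^ (n + 1)) q k
          * qpoch (q powi (- int x)) q k)
        / (qpoch (\<alpha> * q) q k * qpoch (q powi (- int M)) q k * qpoch q q k) * q ^ k)"

definition q_racah :: "real \<Rightarrow> nat \<Rightarrow> nat \<Rightarrow> real \<Rightarrow> real \<Rightarrow> real \<Rightarrow> nat \<Rightarrow> real" where
  "q_racah q n x \<alpha> \<beta> \<delta> M =
     q powi (- (int n * (int M - int n))) *
     ((qpoch (\<beta> * \<delta> * q) q n * qpoch (q powi (int M - int n + 1)) q n)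
       / (qpoch (\<alpha> * \<beta> * q ^ (n + 1)) q n * qpoch q q n)) *
     (\<Sum>k=0..n.
        (qpoch (q powi (- int n)) q k * qpoch (\<delta> * q powi (int x - int M)) q k
          * qpoch (q powi (- int x)) q k * qpoch (\<alpha> * \<beta> * q ^ (n + 1)) q k)
        / (qpoch (\<alpha> * q) q k * qpoch (\<beta> * \<delta> * q) q k
            * qpoch (q powi (- int M)) q k * qpoch q q k) * q ^ k)"

text \<open>The Gasper--Rahman normalization, for \<open>\<delta> > 0\<close>.\<close>

definition q_racah_GR :: "real \<Rightarrow> nat \<Rightarrow> nat \<Rightarrow> real \<Rightarrow> real \<Rightarrow> real \<Rightarrow> nat \<Rightarrow> real" where
  "q_racah_GR q n x \<alpha> \<beta> \<delta> M =
     ((-1) ^ n * qpoch (\<alpha> * \<beta> * q ^ (n + 1)) q n * qpoch (\<alpha> * q) q n * qpoch q q n)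
     / (q powi (- int M + int n + 1) * \<delta>) powr (real n / 2)
     * q_racah q n x \<alpha> \<beta> \<delta> M"

definition psum :: "(nat \<Rightarrow> nat) \<Rightarrow> nat \<Rightarrow> nat" where
  "psum x k = (\<Sum>i=1..k. x i)"

definition pprod :: "(nat \<Rightarrow> real) \<Rightarrow> nat \<Rightarrow> real" where
  "pprod \<alpha> k = (\<Prod>i=1..k. \<alpha> i)"

text \<open>The numbers \<open>j\<^sub>k = m\<^sub>k\<^sub>+\<^sub>1 + \<dots> + m\<^sub>h\<^sub>-\<^sub>1\<close> and \<open>i\<^sub>k = n\<^sub>2 + \<dots> + n\<^sub>k\<^sub>-\<^sub>1\<close>.\<close>

definition jidx :: "nat \<Rightarrow> (nat \<Rightarrow> nat) \<Rightarrow> nat \<Rightarrow> nat" where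
  "jidx h m k = (\<Sum>i=k+1..h-1. m i)"

definition iidx :: "(nat \<Rightarrow> nat) \<Rightarrow> nat \<Rightarrow> nat" where
  "iidx \<nu> k = (\<Sum>i=2..<k. \<nu> i)"

text \<open>
  The natural-number subtractions in the next two definitions are exact whenever the
  corresponding condition of the case distinction holds.
\<close>

definition xi :: "real \<Rightarrow> nat \<Rightarrow> (nat \<Rightarrow> real) \<Rightarrow> (nat \<Rightarrow> nat) \<Rightarrow> (nat \<Rightarrow> nat) \<Rightarrow> real" where
  "xi q h \<alpha> m x =
     (if \<forall>k\<in>{1..h-1}. (\<Sum>i=k..h. x i) \<ge> jidx h m (k - 1) then
        (\<Prod>k=1..h-1. q powi (- int (jidx h m k * x k)) *
           q_hahn q (m k) (x k) (\<alpha> k)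
             (pprod \<alpha> h / pprod \<alpha> k * q powi (int h - int k + 2 * int (jidx h m k) - 1))
             (psum x h - psum x (k - 1) - jidx h m k))
      else 0)"

definition theta :: "real \<Rightarrow> nat \<Rightarrow> (nat \<Rightarrow> real) \<Rightarrow> (nat \<Rightarrow> nat) \<Rightarrow> (nat \<Rightarrow> nat) \<Rightarrow> real" where
  "theta q h \<alpha> \<nu> x =
     (if \<forall>k\<in>{3..h+1}. psum x (k - 1) \<ge> iidx \<nu> k then
        (\<Prod>k=2..h. q_hahn q (\<nu> k) (psum x (k - 1) - iidx \<nu> k)
           (pprod \<alpha> (k - 1) * q powi (int k + 2 * int (iidx \<nu> k) - 2)) (\<alpha> k)
           (psum x k - iidx \<nu> k))
      else 0)"

text \<open>
  The condition \<open>n\<^sub>k \<le> n - i\<^sub>k - j\<^sub>k\<close> is written additively because subtraction on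
  the natural numbers truncates.
\<close>

definition admissible :: "nat \<Rightarrow> nat \<Rightarrow> (nat \<Rightarrow> nat) \<Rightarrow> (nat \<Rightarrow> nat) set" where
  "admissible h n m =
     {\<nu> \<in> compositions {2..h} n. \<forall>k\<in>{2..h-1}. \<nu> k + iidx \<nu> k + jidx h m k \<le> n}"

definition conn_coeff ::
  "real \<Rightarrow> nat \<Rightarrow> (nat \<Rightarrow> real) \<Rightarrow> nat \<Rightarrow> (nat \<Rightarrow> nat) \<Rightarrow> (nat \<Rightarrow> nat) \<Rightarrow> real" where
  "conn_coeff q h \<alpha> n m \<nu> =
     (\<Prod>k=2..h-1. q powi (- int (m k * iidx \<nu> k)) *
        q_racah q (\<nu> k) (m k) (\<alpha> k)
          (pprod \<alpha> (k - 1) * q powi (2 * int (iidx \<nu> k) + int k - 2))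
          (pprod \<alpha> h / pprod \<alpha> (k - 1)
            * q powi (int n + int (jidx h m k) - int (iidx \<nu> k) + int h - int k))
          (n - iidx \<nu> k - jidx h m k))"

text \<open>
  The Gasper--Rahman multidimensional polynomials in \<open>s\<close> variables, with the convention
  \<open>y\<^sub>s\<^sub>+\<^sub>1 = n\<close>. They are meant for \<open>y\<^sub>k \<le> y\<^sub>k\<^sub>+\<^sub>1\<close> and
  \<open>\<nu>\<^sub>1 + \<dots> + \<nu>\<^sub>k \<le> y\<^sub>k\<^sub>+\<^sub>1\<close>.
\<close>

definition multi_q_racah ::
  "real \<Rightarrow> nat \<Rightarrow> (nat \<Rightarrow> nat) \<Rightarrow> (nat \<Rightarrow> nat) \<Rightarrow> (nat \<Rightarrow> real) \<Rightarrow> real \<Rightarrow> nat \<Rightarrow> real" where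
  "multi_q_racah q s \<nu> y a b n =
     (let y' = y(s + 1 := n) in
      \<Prod>k=1..s. q_racah_GR q (\<nu> k) (y' (k + 1) - y' k)
        (a (k + 1) / q)
        (b * pprod a k * q ^ (2 * psum \<nu> (k - 1)) / a 1)
        (1 / pprod a k * q powi (- int (y' (k + 1)) - int (psum \<nu> (k - 1))))
        (y' (k + 1) - psum \<nu> (k - 1)))"

end

(*
The right comb is turned into the left comb by h - 2 tree rotations (a (b c)) -> ((a b) c), each
contributing one q-Racah polynomial; everything reduces to the case of three leaves.  Writing
U = q^u, V = q^v, W = q^w for the (shifted) coordinates of the leaves, all functions involved become
Laurent polynomials, and both sides of the three-leaf identity are eigenfunctions, with the same
eigenvalues, of a raising operator (coordinates lowered by one) and of its adjoint, a lowering
operator.  Two such functions of degree M that vanish below u + v + w = M agree as soon as they agree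
for u = 0 and v + w = M.  There the q-Hahn polynomials of top degree are products, and comparing
coefficients of (q^-m)_k (b c q^(m+1))_k leaves a terminating very-well-poised sum, which is
proved by creative telescoping.
*)
theory Submission
  imports Defs
begin

section \<open>A terminating very-well-poised sum\<close>

text \<open>The q-Hahn sum as defined divides by (q^-M; q)_k and makes sense only for arguments in
  range, whereas both operators step outside the grid. Multiplying the prefactor (q; q)_M / (q;
  q)_(M-n) into the sum clears that denominator: the resulting \<open>hahn\<close> is meaningful at
  all nonzero X, Y and vanishes by itself at X = q^x, Y = q^y with x + y < n. Hence the case
  distinctions of \<open>xi\<close> and \<open>theta\<close> dissolve into plain products of nodes,
  and values off the grid occur only with coefficient 0. The operators pass through a tree because
  the eigenvalue at an inner node, read in the merged coordinate, is up to a power of q a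
  coefficient of the outer node's operator; this explains parameters such as a b q^(2s+1). The two
  ranges allowed for the \<alpha>'s keep denominators away from 0: for k \<le> e \<le> k N, the
  numbers A_k q^e lie all below 1 or all above 1. The half-integer exponents n^2/2 of two adjacent
  nodes of degrees s and M - s add up to M^2/2 - s(M-s), so a rotation sees only integer powers of
  q.\<close>

lemma qpoch_0 [simp]: "qpoch a q 0 = 1"
  by (simp add: qpoch_def)

lemma qpoch_Suc: "qpoch a q (Suc k) = qpoch a q k * (1 - a * q ^ k)"
  by (simp add: qpoch_def)

lemma qpoch_add: "qpoch a q (k + l) = qpoch a q k * qpoch (a * q ^ k) q l"
  by (induction l) (simp_all add: qpoch_Suc power_add mult.assoc)

lemma qpoch_Suc_left: "qpoch a q (Suc k) = (1 - a) * qpoch (a * q) q k"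
  using qpoch_add[of a q 1 k] by (simp add: qpoch_Suc)

lemma qpoch_nonzero: "(\<And>j. j < k \<Longrightarrow> a * q ^ j \<noteq> 1) \<Longrightarrow> qpoch a q k \<noteq> 0"
  by (auto simp: qpoch_def)

lemma qpoch_q_nonzero:
  assumes "0 < q" "q < (1::real)"
  shows "qpoch q q k \<noteq> 0"
proof (rule qpoch_nonzero)
  fix j
  have "q ^ Suc j < 1" using assms by (intro power_Suc_less_one) auto
  then show "q * q ^ j \<noteq> 1" by simp
qed

text \<open>Merging the two denominators into (A q^s; q)_(v+1) / (1 - A q^(2s)) exposes the
  very-well-poised factor. For g nonzero this is the summand of Rogers's terminating 6-phi-5 sum
  with one free numerator parameter sent to 0, divided by the value of the sum. Factors g - A
  q^(s+i+1) in place of a shifted factorial in A/g keep g = 0 allowed, and 1 - A never occurs as a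
  denominator.\<close>

definition wp_term :: "real \<Rightarrow> real \<Rightarrow> real \<Rightarrow> nat \<Rightarrow> nat \<Rightarrow> real" where
  "wp_term q A g v s = qpoch q q v / (qpoch q q s * qpoch q q (v - s))
     * qpoch g q s / qpoch (A * q ^ s) q s
     * (\<Prod>i<v - s. (g - A * q ^ (s + i + 1)) / (1 - A * q ^ (2 * s + i + 1)))"

text \<open>Induction on \<open>v\<close>: the summands for v + 1 and for v differ by H s - H (s-1),
  so the sum over s \<le> v changes by \<open>H v\<close>, and the new term s = v + 1 equals
  \<open>- H v\<close>.\<close>

lemma wp_sum:
  assumes q: "0 < q" "q < 1" and A: "\<And>j. 1 \<le> j \<Longrightarrow> j < 2 * v \<Longrightarrow> A * q ^ j \<noteq> 1"
  shows "(\<Sum>s\<le>v. wp_term q A g v s) = 1"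
  using A
proof (induction v)
  case 0
  then show ?case by (simp add: wp_term_def)
next
  case (Suc v)
  \<comment> \<open>the Wilf--Zeilberger certificate of the sum\<close>
  define H where "H s = - (qpoch q q v / (qpoch q q s * qpoch q q (v - s))) * qpoch g q (Suc s)
      * (\<Prod>i<v - s. g - A * q ^ (s + i + 1)) / qpoch (A * q ^ Suc s) q (Suc v)" for s
  have qn [simp]: "qpoch q q k \<noteq> 0" for k using qpoch_q_nonzero q by blast
  have An: "A * q ^ j \<noteq> 1" if "1 \<le> j" "j < 2 * v + 2" for j using Suc.prems that by simp
  have IH: "(\<Sum>s\<le>v. wp_term q A g v s) = 1" by (rule Suc.IH) (use An in auto)
  have key: "(\<Sum>s\<le>r. wp_term q A g (Suc v) s - wp_term q A g v s) = H r" if "r \<le> v" for r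
    using that
  proof (induction r)
    case 0
    have p: "qpoch (A * q) q k = (\<Prod>i<k. 1 - A * q ^ (i + 1))" for k
      by (simp add: qpoch_def mult.assoc)
    have n1: "(\<Prod>i<v. 1 - A * q ^ (i + 1)) \<noteq> 0"
      using An by (auto simp del: power_Suc)
    have n2: "1 - A * q ^ (v + 1) \<noteq> 0" using An[of "v + 1"] by auto
    have n3: "1 - q * q ^ v \<noteq> 0" using qn[of "Suc v"] by (simp add: qpoch_Suc)
    show ?case using n1 n2 n3
      by (simp add: wp_term_def H_def p prod_dividef qpoch_Suc divide_simps) (simp add: algebra_simps)
  next
    case (Suc r)
    define s where "s = Suc r"
    have sv: "s \<le> v" using Suc.prems s_def by simp
    define P where "P = (\<Prod>i<v - s. g - A * q ^ (s + i + 1))"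
    define D1 where "D1 = qpoch (A * q ^ s) q s"
    define D2 where "D2 = (\<Prod>i<v - s. 1 - A * q ^ (2 * s + i + 1))"
    \<comment> \<open>\<open>e\<close> is the very-well-poised factor. All four quantities
      \<open>wp_term ... (Suc v) s\<close>, \<open>wp_term ... v s\<close>, \<open>H s\<close> and
      \<open>H r\<close> are brought over the common denominator D1 D2 e f, with \<open>d\<close>
      moving to the numerator of \<open>H s\<close>.\<close>
    define e where "e = 1 - A * q ^ (2 * s)"
    define f where "f = 1 - A * q ^ (s + v + 1)"
    define d where "d = 1 - A * q ^ s"
    define b where "b = qpoch q q v / (qpoch q q s * qpoch q q (Suc v - s))"
    have nz: "e \<noteq> 0" "f \<noteq> 0" "d \<noteq> 0"
      unfolding e_def f_def d_def using An[of "2*s"] An[of "s+v+1"] An[of s] sv s_def by auto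
    have nD: "D1 \<noteq> 0" "D2 \<noteq> 0"
    proof -
      show "D1 \<noteq> 0" unfolding D1_def
      proof (rule qpoch_nonzero)
        fix j assume "j < s"
        then show "A * q ^ s * q ^ j \<noteq> 1" using An[of "s + j"] sv s_def by (simp add: power_add mult.assoc)
      qed
      show "D2 \<noteq> 0" unfolding D2_def using An sv s_def by (auto simp del: power_Suc)
    qed
    have d1: "qpoch (A * q ^ s) q (Suc v) = D1 * e * D2"
    proof -
      have "Suc v = s + (1 + (v - s))" using sv by simp
      then have "qpoch (A * q ^ s) q (Suc v)
          = D1 * (qpoch (A * q ^ s * q ^ s) q 1 * qpoch (A * q ^ s * q ^ s * q ^ 1) q (v - s))"
        unfolding D1_def by (simp only: qpoch_add)
      also have "qpoch (A * q ^ s * q ^ s) q 1 = e" 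
        by (simp add: qpoch_def e_def mult_2 power_add mult.assoc)
      also have "qpoch (A * q ^ s * q ^ s * q ^ 1) q (v - s) = D2"
        by (simp add: qpoch_def D2_def mult_2 power_add mult.assoc mult.left_commute)
      finally show ?thesis by simp
    qed
    have d2: "qpoch (A * q ^ Suc s) q (Suc v) = D1 * e * D2 * f / d"
    proof -
      have "d * qpoch (A * q ^ Suc s) q (Suc v) = qpoch (A * q ^ s) q (Suc (Suc v))"
        by (subst (2) qpoch_Suc_left) (simp add: d_def mult_ac)
      also have "\<dots> = D1 * e * D2 * f" 
        by (subst qpoch_Suc) (simp only: d1 f_def, simp add: power_add mult_ac)
      finally show ?thesis using nz by (simp add: field_simps)
    qed
    have qs: "qpoch q q s = qpoch q q r * (1 - q ^ s)" unfolding s_def by (simp add: qpoch_Suc)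
    have qvs: "qpoch q q (Suc v - s) = qpoch q q (v - s) * (1 - q ^ (Suc v - s))"
      using sv by (simp add: Suc_diff_le qpoch_Suc)
    have ns: "1 - q ^ s \<noteq> 0" "1 - q ^ (Suc v - s) \<noteq> 0" 
      using qn[of s] qn[of "Suc v - s"] unfolding qs qvs by auto
    have vr: "v - r = Suc v - s" "v - r = Suc (v - s)" using sv s_def by auto
    have t0: "wp_term q A g v s = b * (1 - q ^ (Suc v - s)) * qpoch g q s * P / (D1 * D2)"
    proof -
      have "qpoch q q v / (qpoch q q s * qpoch q q (v - s)) = b * (1 - q ^ (Suc v - s))"
        using ns by (simp add: b_def qvs)
      then show ?thesis
        by (simp add: wp_term_def P_def D1_def D2_def prod_dividef)
    qed
    have svS: "Suc v - s = Suc (v - s)" using sv by simp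
    have t1: "wp_term q A g (Suc v) s
        = b * (1 - q ^ Suc v) * qpoch g q s * P * (g - A * q ^ Suc v) / (D1 * D2 * f)"
    proof -
      have "(\<Prod>i<Suc v - s. (g - A * q ^ (s + i + 1)) / (1 - A * q ^ (2 * s + i + 1)))
         = P * (g - A * q ^ Suc v) / (D2 * f)"
        using sv by (simp add: svS prod_dividef P_def D2_def f_def mult_2)
      then show ?thesis
        by (simp add: wp_term_def b_def D1_def qpoch_Suc)
    qed
    have Hr: "H r = - b * (1 - q ^ s) * qpoch g q s * (g - A * q ^ s) * P / (D1 * e * D2)"
    proof -
      have "(\<Prod>i<v - r. g - A * q ^ (r + i + 1)) = (g - A * q ^ s) * P"
        unfolding vr(2) by (subst prod.lessThan_Suc_shift) (simp add: P_def s_def)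
      then show ?thesis using ns
        unfolding H_def vr(1)[symmetric] s_def[symmetric] d1
        by (simp add: b_def qs vr(1))
    qed
    have Hs: "H s = - b * (1 - q ^ (Suc v - s)) * qpoch g q s * (1 - g * q ^ s) * P * d / (D1 * e * D2 * f)"
      using ns nz nD unfolding H_def d2
      by (simp add: b_def qvs P_def qpoch_Suc)
    define z y where "z = q ^ s" and "y = q ^ (Suc v - s)"
    have zy: "q ^ Suc v = z * y" "q ^ (2 * s) = z * z" "q ^ (s + v + 1) = z * z * y"
      using sv by (simp_all add: z_def y_def mult_2 flip: power_add power_Suc)
    \<comment> \<open>After the common factor \<open>K\<close> is removed, the telescoping relation
      is a polynomial identity in A, g, z, y, where z y = q^(v+1).\<close>
    have bal: "e * ((1 - q ^ Suc v) * (g - A * q ^ Suc v)) - (1 - y) * e * f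
        = (1 - z) * (g - A * z) * f - (1 - y) * (1 - g * z) * d"
      unfolding e_def f_def d_def zy z_def[symmetric] by (simp add: algebra_simps)
    define K where "K = b * qpoch g q s * P / (D1 * D2 * e * f)"
    have "wp_term q A g (Suc v) s = K * (e * ((1 - q ^ Suc v) * (g - A * q ^ Suc v)))"
        "wp_term q A g v s = K * ((1 - y) * e * f)"
        "H s = - K * ((1 - y) * (1 - g * z) * d)"
        "H r = - K * ((1 - z) * (g - A * z) * f)"
      unfolding t0 t1 Hr Hs z_def[symmetric] y_def[symmetric] K_def using nz nD by (simp_all add: mult_ac)
    then have "wp_term q A g (Suc v) s - wp_term q A g v s
          = K * (e * ((1 - q ^ Suc v) * (g - A * q ^ Suc v)) - (1 - y) * e * f)"
        "H s - H r = K * ((1 - z) * (g - A * z) * f - (1 - y) * (1 - g * z) * d)"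
      by (simp_all only: right_diff_distrib)
    with bal have "wp_term q A g (Suc v) s - wp_term q A g v s = H s - H r" by simp
    then show ?case using Suc sv by (simp add: s_def)
  qed
  have "(\<Sum>s\<le>Suc v. wp_term q A g (Suc v) s)
      = (\<Sum>s\<le>v. wp_term q A g (Suc v) s - wp_term q A g v s) + (\<Sum>s\<le>v. wp_term q A g v s)
        + wp_term q A g (Suc v) (Suc v)"
    by (simp add: sum_subtractf)
  also have "\<dots> = H v + 1 + wp_term q A g (Suc v) (Suc v)"
    using key[of v] IH by simp
  also have "wp_term q A g (Suc v) (Suc v) = - H v"
    by (simp add: wp_term_def H_def)
  finally show ?case by simp
qed

text \<open>With X = q^x this turns (q^-x; q)_k into a polynomial in X divided by X^k, up to a
  factor that does not depend on x.\<close>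

lemma qpoch_inverse:
  assumes "X \<noteq> 0" "q \<noteq> 0"
  shows "qpoch (inverse X) q k = (\<Prod>j<k. - (q ^ j)) * (\<Prod>j<k. 1 - X / q ^ j) / X ^ k"
  using assms
proof (induction k)
  case (Suc k)
  then have "1 - inverse X * q ^ k = - (q ^ k) * (1 - X / q ^ k) / X"
    by (simp add: field_simps)
  with Suc show ?case by (simp add: qpoch_Suc mult_ac)
qed simp

lemma prod_one_minus_power_eq_0:
  fixes q :: real
  assumes "q \<noteq> 0" "s < k"
  shows "(\<Prod>j<k. 1 - q ^ s / q ^ j) = 0"
  using assms by (intro prod_zero bexI[of _ s]) auto

lemma prod_one_minus_power_eq_qpoch:
  assumes "q \<noteq> 0" "k \<le> s"
  shows "qpoch q q (s - k) * (\<Prod>j<k. 1 - q ^ s / q ^ j) = qpoch q q s"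
  using assms(2)
proof (induction k)
  case (Suc k)
  then have "s - k = Suc (s - Suc k)" by simp
  then have "qpoch q q (s - k) = qpoch q q (s - Suc k) * (1 - q ^ (s - k))"
    by (simp add: qpoch_Suc)
  moreover have "q ^ s / q ^ k = q ^ (s - k)" using Suc assms by (simp add: power_diff)
  ultimately show ?case using Suc by (simp add: mult_ac)
qed simp

text \<open>The factor (q^-s; q)_k kills the terms with s < k. Substituting s = t + k turns the
  remaining ones into a constant times the terms with parameters A q^(2k), g q^k and v - k, whose
  sum is 1. Thus summation over s replaces (q^-s)_k (A q^s)_k by (q^-v)_k (g)_k, which is the form
  needed for comparing coefficients.\<close>

lemma wp_sum_shift:
  assumes q: "0 < q" "q < 1" and A: "\<And>j. 1 \<le> j \<Longrightarrow> j < 2 * v \<Longrightarrow> A * q ^ j \<noteq> 1"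
  shows "(\<Sum>s\<le>v. wp_term q A g v s * (qpoch (q powi (- int s)) q k * qpoch (A * q ^ s) q k))
    = qpoch (q powi (- int v)) q k * qpoch g q k"
proof -
  have q0: "q \<noteq> 0" using q by simp
  have qn [simp]: "qpoch q q i \<noteq> 0" for i using qpoch_q_nonzero q by blast
  define c where "c = (\<Prod>j<k. - (q ^ j))"
  have neg: "qpoch (q powi (- int s)) q k = c * (\<Prod>j<k. 1 - q ^ s / q ^ j) / (q ^ s) ^ k" for s
    using qpoch_inverse[of "q ^ s" q k] q0 by (simp add: power_int_minus c_def)
  have neg0: "qpoch (q powi (- int s)) q k = 0" if "s < k" for s
    using that q0 by (simp add: neg prod_one_minus_power_eq_0)
  have neg1: "qpoch (q powi (- int s)) q k = c * qpoch q q s / ((q ^ s) ^ k * qpoch q q (s - k))" if "k \<le> s" for s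
    unfolding neg prod_one_minus_power_eq_qpoch[OF q0 that, symmetric] by simp
  show ?thesis
  proof (cases "k \<le> v")
    case False
    then show ?thesis by (simp add: neg0)
  next
    case True
    have shift: "wp_term q A g v (t + k) * (qpoch (q powi (- int (t + k))) q k * qpoch (A * q ^ (t + k)) q k)
        = qpoch (q powi (- int v)) q k * qpoch g q k * wp_term q (A * q ^ (2 * k)) (g * q ^ k) (v - k) t"
      if t: "t \<le> v - k" for t
    proof -
      have nA: "qpoch (A * q ^ (t + k)) q k \<noteq> 0"
      proof (rule qpoch_nonzero)
        fix j assume "j < k"
        then show "A * q ^ (t + k) * q ^ j \<noteq> 1"
          using A[of "t + k + j"] t True by (simp add: power_add mult.assoc)
      qed
      have g: "qpoch g q (t + k) = qpoch g q k * qpoch (g * q ^ k) q t"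
        using qpoch_add[of g q k t] by (simp add: add.commute)
      have d: "qpoch (A * q ^ (t + k)) q (t + k)
          = qpoch (A * q ^ (t + k)) q k * qpoch (A * q ^ (2 * k) * q ^ t) q t"
        using qpoch_add[of "A * q ^ (t + k)" q k t] by (simp add: add.commute power_add mult_2 mult_2_right mult_ac)
      have w: "v - (t + k) = v - k - t" using t by simp
      have p: "(\<Prod>i<v - k - t. (g * q ^ k - A * q ^ (2 * k) * q ^ (t + i + 1))
            / (1 - A * q ^ (2 * k) * q ^ (2 * t + i + 1)))
          = (q ^ k) ^ (v - k - t) * (\<Prod>i<v - k - t. (g - A * q ^ (t + k + i + 1)) / (1 - A * q ^ (2 * (t + k) + i + 1)))"
      proof -
        have "(\<Prod>i<v - k - t. (g * q ^ k - A * q ^ (2 * k) * q ^ (t + i + 1))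
            / (1 - A * q ^ (2 * k) * q ^ (2 * t + i + 1)))
          = (\<Prod>i<v - k - t. q ^ k * ((g - A * q ^ (t + k + i + 1)) / (1 - A * q ^ (2 * (t + k) + i + 1))))"
          by (intro prod.cong refl) (simp add: power_add mult_2 mult_2_right mult_ac right_diff_distrib)
        then show ?thesis by (simp only: prod.distrib prod_constant card_lessThan)
      qed
      have e: "(q ^ v) ^ k = (q ^ (t + k)) ^ k * (q ^ k) ^ (v - k - t)"
      proof -
        have "v * k = (t + k) * k + k * (v - k - t)"
          using t True by (metis add_mult_distrib2 le_add_diff_inverse mult.commute add.commute
              diff_diff_add le_diff_conv2 w)
        then show ?thesis by (simp flip: power_mult power_add)
      qed
      show ?thesis
        unfolding wp_term_def neg1[OF True] neg1[OF le_add2[of k t]] diff_add_inverse2 g d w p e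
        using nA q0 by (simp add: mult_ac)
    qed
    have "(\<Sum>s\<le>v. wp_term q A g v s * (qpoch (q powi (- int s)) q k * qpoch (A * q ^ s) q k))
        = (\<Sum>s\<in>{k..v}. wp_term q A g v s * (qpoch (q powi (- int s)) q k * qpoch (A * q ^ s) q k))"
      by (rule sum.mono_neutral_right) (auto simp: neg0)
    also have "\<dots> = (\<Sum>t\<le>v - k. wp_term q A g v (t + k) * (qpoch (q powi (- int (t + k))) q k * qpoch (A * q ^ (t + k)) q k))"
      using True by (intro sum.reindex_bij_witness[of _ "\<lambda>t. t + k" "\<lambda>s. s - k"]) auto
    also have "\<dots> = (\<Sum>t\<le>v - k. qpoch (q powi (- int v)) q k * qpoch g q k * wp_term q (A * q ^ (2 * k)) (g * q ^ k) (v - k) t)"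
      by (rule sum.cong) (use shift in auto)
    also have "\<dots> = qpoch (q powi (- int v)) q k * qpoch g q k
        * (\<Sum>t\<le>v - k. wp_term q (A * q ^ (2 * k)) (g * q ^ k) (v - k) t)"
      by (simp add: sum_distrib_left)
    also have "(\<Sum>t\<le>v - k. wp_term q (A * q ^ (2 * k)) (g * q ^ k) (v - k) t) = 1"
    proof (rule wp_sum[OF q])
      fix j assume "1 \<le> j" "j < 2 * (v - k)"
      then show "A * q ^ (2 * k) * q ^ j \<noteq> 1"
        using A[of "2 * k + j"] by (simp add: power_add mult.assoc)
    qed
    finally show ?thesis by simp
  qed
qed

section \<open>The $q$-Hahn polynomials in exponential coordinates\<close>

text \<open>The part of the k-th q-Hahn summand that involves neither the variable nor the size
  parameter.\<close>

definition hahn_coeff :: "real \<Rightarrow> nat \<Rightarrow> real \<Rightarrow> real \<Rightarrow> nat \<Rightarrow> real" where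
  "hahn_coeff q n a b k = qpoch (q powi (- int n)) q k * qpoch (a * b * q ^ (n + 1)) q k
     / (qpoch (a * q) q k * qpoch q q k) * q ^ k"

text \<open>At X = q^x, Y = q^(M-x) this is (q; q)_M / (q; q)_(M-n) times (q^-x; q)_k / (q^-M; q)_k.
  The last product is what the prefactor leaves after cancelling (q^-M; q)_k, so nothing is divided
  by a quantity depending on X or Y.\<close>

definition hahn_mono :: "real \<Rightarrow> nat \<Rightarrow> nat \<Rightarrow> real \<Rightarrow> real \<Rightarrow> real" where
  "hahn_mono q n k X Y = Y ^ k * (\<Prod>j<k. 1 - X / q ^ j) * (\<Prod>j=k..<n. 1 - X * Y / q ^ j)"

definition hahn :: "real \<Rightarrow> nat \<Rightarrow> real \<Rightarrow> real \<Rightarrow> real \<Rightarrow> real \<Rightarrow> real" where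
  "hahn q n a b X Y = (\<Sum>k\<le>n. hahn_coeff q n a b k * hahn_mono q n k X Y) / (X * Y) ^ n"

section \<open>Raising and lowering relations in one variable\<close>

lemma hahn_coeff_Suc:
  assumes q: "0 < q" "q < 1" and "a * q ^ Suc k \<noteq> 1"
  shows "hahn_coeff q n a b (Suc k) * ((1 - q ^ Suc k) * (1 - a * q ^ Suc k))
    = hahn_coeff q n a b k * ((1 - q ^ k / q ^ n) * (1 - a * b * q ^ (n + 1 + k)) * q)"
proof -
  have "qpoch q q (Suc k) \<noteq> 0" by (rule qpoch_q_nonzero[OF q])
  then have "1 - q ^ Suc k \<noteq> 0" by (simp add: qpoch_Suc)
  moreover have "1 - a * q ^ Suc k \<noteq> 0" using assms by simp
  ultimately show ?thesis
    unfolding hahn_coeff_def using q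
    by (simp add: qpoch_Suc power_int_minus power_add divide_simps mult_ac)
qed

text \<open>Multiplication by 1 - X completes the shifted product at its lower end, and the shift
  frees a factor at its upper end. The relation holds for each k separately, so the raising relation
  of \<open>hahn\<close> does not depend on the coefficients, hence not on a and b.\<close>

lemma hahn_mono_raise:
  assumes "q \<noteq> 0" "k \<le> n"
  shows "(1 - X) * hahn_mono q n k (X / q) Y + X * (1 - Y) * hahn_mono q n k X (Y / q)
    = (1 - X * Y / q ^ n) * hahn_mono q n k X Y"
proof -
  define P where "P = (\<Prod>j<k. 1 - X / q ^ j)"
  define Q where "Q = (\<Prod>j=Suc k..<Suc n. 1 - X * Y / q ^ j)"
  have "(1 - X) * (\<Prod>j<k. 1 - X / q / q ^ j) = (\<Prod>j<Suc k. 1 - X / q ^ j)"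
    by (subst prod.lessThan_Suc_shift) simp
  then have 1: "(1 - X) * (\<Prod>j<k. 1 - X / q / q ^ j) = P * (1 - X / q ^ k)"
    by (simp add: P_def)
  have 2: "(\<Prod>j=k..<n. 1 - X * Y / q / q ^ j) = Q"
    unfolding Q_def by (subst prod.shift_bounds_Suc_ivl) simp
  have 3: "(1 - X * Y / q ^ k) * Q = (\<Prod>j=k..<n. 1 - X * Y / q ^ j) * (1 - X * Y / q ^ n)"
    unfolding Q_def using assms(2)
    by (subst prod.atLeast_Suc_lessThan[symmetric]) auto
  have "(1 - X) * hahn_mono q n k (X / q) Y = Y ^ k * (P * (1 - X / q ^ k)) * Q"
    using 2 by (simp only: hahn_mono_def 1[symmetric]) simp
  moreover have "X * (1 - Y) * hahn_mono q n k X (Y / q) = X * (1 - Y) * (Y ^ k / q ^ k) * P * Q"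
    using 2 by (simp add: hahn_mono_def P_def power_divide)
  moreover have "(1 - X * Y / q ^ n) * hahn_mono q n k X Y = Y ^ k * P * ((1 - X * Y / q ^ k) * Q)"
    by (simp add: hahn_mono_def P_def 3)
  moreover have "Y ^ k * (P * (1 - X / q ^ k)) * Q + X * (1 - Y) * (Y ^ k / q ^ k) * P * Q
      = Y ^ k * P * ((1 - X * Y / q ^ k) * Q)"
    using assms by (simp add: field_simps)
  ultimately show ?thesis by simp
qed

lemma hahn_raise:
  assumes "q \<noteq> 0" "X \<noteq> 0" "Y \<noteq> 0"
  shows "(1 - X) * hahn q n a b (X / q) Y + X * (1 - Y) * hahn q n a b X (Y / q)
    = (q ^ n - X * Y) * hahn q n a b X Y"
proof -
  let ?c = "hahn_coeff q n a b"
  have "(1 - X) * (\<Sum>k\<le>n. ?c k * hahn_mono q n k (X / q) Y)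
      + X * (1 - Y) * (\<Sum>k\<le>n. ?c k * hahn_mono q n k X (Y / q))
      = (\<Sum>k\<le>n. ?c k * ((1 - X) * hahn_mono q n k (X / q) Y + X * (1 - Y) * hahn_mono q n k X (Y / q)))"
    unfolding sum_distrib_left sum.distrib[symmetric]
    by (intro sum.cong) (auto simp: algebra_simps)
  also have "\<dots> = (\<Sum>k\<le>n. ?c k * ((1 - X * Y / q ^ n) * hahn_mono q n k X Y))"
    using assms by (intro sum.cong) (auto simp: hahn_mono_raise)
  also have "\<dots> = (1 - X * Y / q ^ n) * (\<Sum>k\<le>n. ?c k * hahn_mono q n k X Y)"
    by (simp add: sum_distrib_left mult_ac)
  finally have E: "(1 - X) * (\<Sum>k\<le>n. ?c k * hahn_mono q n k (X / q) Y)
      + X * (1 - Y) * (\<Sum>k\<le>n. ?c k * hahn_mono q n k X (Y / q))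
      = (1 - X * Y / q ^ n) * (\<Sum>k\<le>n. ?c k * hahn_mono q n k X Y)" .
  have "(1 - X) * hahn q n a b (X / q) Y + X * (1 - Y) * hahn q n a b X (Y / q)
      = ((1 - X) * (\<Sum>k\<le>n. ?c k * hahn_mono q n k (X / q) Y)
      + X * (1 - Y) * (\<Sum>k\<le>n. ?c k * hahn_mono q n k X (Y / q))) / ((X * Y) ^ n / q ^ n)"
    by (simp add: hahn_def power_divide add_divide_distrib distrib_right)
  also have "\<dots> = (q ^ n - X * Y) * hahn q n a b X Y"
    unfolding E hahn_def using assms by (simp add: field_simps)
  finally show ?thesis .
qed

text \<open>Unlike raising, lowering does not act diagonally on the monomials: each image is an
  eigenvalue multiple plus a surplus. The recurrence \<open>hahn_coeff_Suc\<close> makes these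
  surpluses telescope over k.\<close>

lemma hahn_lower_sum:
  assumes q: "0 < q" "q < 1" and a: "\<And>j. 1 \<le> j \<Longrightarrow> j \<le> n \<Longrightarrow> a * q ^ j \<noteq> 1"
  shows "(1 - a * q * X) * (\<Sum>k\<le>n. hahn_coeff q n a b k * hahn_mono q n k (q * X) Y)
      + a * q * X * (1 - b * q * Y) * (\<Sum>k\<le>n. hahn_coeff q n a b k * hahn_mono q n k X (q * Y))
    = (1 - a * b * q ^ (n + 2) * (X * Y)) * (\<Sum>k\<le>n. hahn_coeff q n a b k * hahn_mono q n k X Y)"
proof (cases n)
  case 0
  then show ?thesis
    by (simp add: hahn_mono_def hahn_coeff_def) (simp add: algebra_simps power2_eq_square)
next
  case (Suc p)
  define c where "c = hahn_coeff q n a b"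
  define Z where "Z = X * Y"
  define P where "P k = Y ^ k * (\<Prod>j<k. 1 - X / q ^ j)" for k
  \<comment> \<open>\<open>hh k\<close> is the monomial of degree p = n - 1, the largest factor
    common to all the terms that meet at index k.\<close>
  define hh where "hh k = P k * (\<Prod>j=k..<p. 1 - Z / q ^ j)" for k
  define D where "D k = (1 - a * q * X) * hahn_mono q n k (q * X) Y
      + a * q * X * (1 - b * q * Y) * hahn_mono q n k X (q * Y)" for k
  have q0: "q \<noteq> 0" using q by simp
  have PS: "P (Suc k) = P k * (Y - Z / q ^ k)" for k
    by (simp add: P_def Z_def algebra_simps)
  have shift: "(\<Prod>j=Suc k..<Suc p. 1 - q * Z / q ^ j) = (\<Prod>j=k..<p. 1 - Z / q ^ j)" for k
    using q0 by (subst prod.shift_bounds_Suc_ivl) simp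
  have m1: "hahn_mono q n (Suc k) (q * X) Y = Y * (1 - q * X) * hh k" for k
  proof -
    have "(\<Prod>j<Suc k. 1 - q * X / q ^ j) = (1 - q * X) * (\<Prod>j<k. 1 - X / q ^ j)"
      using q0 by (subst prod.lessThan_Suc_shift) simp
    then show ?thesis
      unfolding hahn_mono_def hh_def Suc using shift[of k] by (simp add: Z_def P_def mult_ac del: prod.lessThan_Suc)
  qed
  have m2: "hahn_mono q n (Suc k) X (q * Y) = q * q ^ k * (Y - Z / q ^ k) * hh k" for k
  proof -
    have "hahn_mono q n (Suc k) X (q * Y) = q ^ Suc k * P (Suc k) * (\<Prod>j=Suc k..<Suc p. 1 - q * Z / q ^ j)"
      by (simp add: hahn_mono_def Suc P_def Z_def power_mult_distrib mult_ac)
    then show ?thesis unfolding shift PS by (simp add: hh_def)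
  qed
  have D0: "D 0 = (1 - a * b * q ^ 2 * Z) * (1 - q * Z) * hh 0"
  proof -
    have "(\<Prod>j=0..<Suc p. 1 - q * Z / q ^ j) = (1 - q * Z) * hh 0"
      unfolding hh_def using shift[of 0] by (subst prod.atLeast_Suc_lessThan) (auto simp: P_def)
    then have "hahn_mono q n 0 (q * X) Y = (1 - q * Z) * hh 0" "hahn_mono q n 0 X (q * Y) = (1 - q * Z) * hh 0"
      by (simp_all add: hahn_mono_def Suc Z_def mult_ac)
    then show ?thesis unfolding D_def
      by (simp add: Z_def power2_eq_square) (simp add: algebra_simps)
  qed
  \<comment> \<open>The split is chosen so that the second part carries (1 - q^(k+1)) (1 - a
    q^(k+1)), exactly the factor through which the recurrence passes from \<open>c (Suc k)\<close>
    to \<open>c k\<close>.\<close>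
  have DS: "D (Suc k) = (1 - a * b * q ^ (k + 3) * Z) * ((Y - Z / q ^ k) * hh k)
      + (1 - q ^ Suc k) * (1 - a * q ^ Suc k) * (Z / q ^ k) * hh k" for k
  proof -
    define y where "y = q ^ k"
    have "y \<noteq> 0" using q0 y_def by simp
    then have "(1 - a * q * X) * (Y * (1 - q * X)) + a * q * X * (1 - b * q * Y) * (q * y * (Y - Z / y))
       = (1 - a * b * q ^ 3 * y * Z) * (Y - Z / y) + (1 - q * y) * (1 - a * q * y) * (Z / y)"
      unfolding Z_def by (simp add: field_simps power3_eq_cube)
    then have "((1 - a * q * X) * (Y * (1 - q * X)) + a * q * X * (1 - b * q * Y) * (q * y * (Y - Z / y))) * hh k
       = ((1 - a * b * q ^ 3 * y * Z) * (Y - Z / y) + (1 - q * y) * (1 - a * q * y) * (Z / y)) * hh k" by simp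
    then show ?thesis unfolding D_def m1 m2 y_def
      by (simp add: power_add power3_eq_cube algebra_simps)
  qed
  have hS: "(Y - Z / q ^ k) * hh k = (1 - Z / q ^ k) * hh (Suc k)" if "k < p" for k
  proof -
    have "(\<Prod>j=k..<p. 1 - Z / q ^ j) = (1 - Z / q ^ k) * (\<Prod>j=Suc k..<p. 1 - Z / q ^ j)"
      using that by (subst prod.atLeast_Suc_lessThan) auto
    then show ?thesis by (simp add: hh_def PS mult_ac)
  qed
  have g: "hahn_mono q n k X Y = (1 - Z / q ^ p) * hh k" if "k \<le> p" for k
    using that by (simp add: hahn_mono_def hh_def P_def Suc Z_def mult_ac)
  have gn: "hahn_mono q n n X Y = (Y - Z / q ^ p) * hh p"
    unfolding Suc by (simp add: hahn_mono_def hh_def PS[unfolded P_def] P_def Z_def algebra_simps)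
  define L where "L = 1 - a * b * q ^ (n + 2) * Z"
  have cS: "c (Suc k) * ((1 - q ^ Suc k) * (1 - a * q ^ Suc k))
      = c k * ((1 - q ^ k / q ^ n) * (1 - a * b * q ^ (n + 1 + k)) * q)" if "k \<le> p" for k
    unfolding c_def by (rule hahn_coeff_Suc[OF q]) (use a[of "Suc k"] that Suc in simp)
  \<comment> \<open>The first part of \<open>D k\<close> is \<open>L\<close> times the monomial
    minus the surplus that the second part of \<open>D (Suc k)\<close> returns.\<close>
  have bal: "(1 - a * b * q ^ (k + 2) * Z) * (1 - q * Z / q ^ k)
      = L * (1 - Z / q ^ p) - (1 - q ^ k / q ^ n) * (1 - a * b * q ^ (n + 1 + k)) * (q * Z / q ^ k)" for k
  proof -
    define x y where "x = q ^ k" and "y = q ^ p"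
    have "x \<noteq> 0" "y \<noteq> 0" using q0 x_def y_def by auto
    then show ?thesis unfolding L_def Suc using q0
      by (simp add: power_add x_def[symmetric] y_def[symmetric] field_simps power2_eq_square)
  qed
  have part: "(\<Sum>k\<le>r. c k * D k) = L * (\<Sum>k\<le>r. c k * hahn_mono q n k X Y)
      - c r * ((1 - q ^ r / q ^ n) * (1 - a * b * q ^ (n + 1 + r)) * (q * Z / q ^ r)) * hh r" if "r \<le> p" for r
    using that
  proof (induction r)
    case 0
    have "c 0 * D 0 = c 0 * ((1 - a * b * q ^ (0 + 2) * Z) * (1 - q * Z / q ^ 0)) * hh 0"
      by (simp add: D0 power2_eq_square)
    also have "\<dots> = L * (c 0 * hahn_mono q n 0 X Y)
        - c 0 * ((1 - q ^ 0 / q ^ n) * (1 - a * b * q ^ (n + 1 + 0)) * (q * Z / q ^ 0)) * hh 0"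
      unfolding bal g[OF le0] by (simp only: algebra_simps)
    finally show ?case by simp
  next
    case (Suc r)
    have r: "r < p" "r \<le> p" using Suc.prems by auto
    have "c (Suc r) * D (Suc r) = c (Suc r) * (1 - a * b * q ^ (Suc r + 2) * Z) * ((Y - Z / q ^ r) * hh r)
      + c (Suc r) * ((1 - q ^ Suc r) * (1 - a * q ^ Suc r)) * (Z / q ^ r) * hh r"
      unfolding DS by (simp add: algebra_simps numeral_3_eq_3)
    also have "\<dots> = c (Suc r) * ((1 - a * b * q ^ (Suc r + 2) * Z) * (1 - q * Z / q ^ Suc r)) * hh (Suc r)
      + c r * ((1 - q ^ r / q ^ n) * (1 - a * b * q ^ (n + 1 + r)) * (q * Z / q ^ r)) * hh r"
      unfolding hS[OF r(1)] cS[OF r(2)] using q0 by simp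
    also have "c (Suc r) * ((1 - a * b * q ^ (Suc r + 2) * Z) * (1 - q * Z / q ^ Suc r)) * hh (Suc r)
      = L * (c (Suc r) * hahn_mono q n (Suc r) X Y)
        - c (Suc r) * ((1 - q ^ Suc r / q ^ n) * (1 - a * b * q ^ (n + 1 + Suc r)) * (q * Z / q ^ Suc r)) * hh (Suc r)"
      unfolding bal g[OF Suc.prems] by (simp only: algebra_simps)
    finally show ?case unfolding sum.atMost_Suc Suc.IH[OF r(2)] distrib_left
      by linarith
  qed
  have "(\<Sum>k\<le>n. c k * D k) = (\<Sum>k\<le>p. c k * D k) + c (Suc p) * D (Suc p)"
    by (simp add: Suc)
  \<comment> \<open>The top monomial k = n lacks the factor 1 - Z/q^p of the others and needs
    \<open>gn\<close>; its second part cancels the surplus left in \<open>part\<close> at r =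
    p.\<close>
  also have "c (Suc p) * D (Suc p) = c n * L * hahn_mono q n n X Y
      + c (Suc p) * ((1 - q ^ Suc p) * (1 - a * q ^ Suc p)) * (Z / q ^ p) * hh p"
    unfolding DS gn L_def by (simp add: algebra_simps numeral_3_eq_3 Suc)
  also have "\<dots> = c n * L * hahn_mono q n n X Y
      + c p * ((1 - q ^ p / q ^ n) * (1 - a * b * q ^ (n + 1 + p)) * (q * Z / q ^ p)) * hh p"
    unfolding cS[OF order_refl] by simp
  finally have "(\<Sum>k\<le>n. c k * D k) = L * (\<Sum>k\<le>n. c k * hahn_mono q n k X Y)"
    unfolding part[OF order_refl] by (simp add: Suc algebra_simps)
  moreover have "(\<Sum>k\<le>n. c k * D k) = (1 - a * q * X) * (\<Sum>k\<le>n. c k * hahn_mono q n k (q * X) Y)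
      + a * q * X * (1 - b * q * Y) * (\<Sum>k\<le>n. c k * hahn_mono q n k X (q * Y))"
    unfolding sum_distrib_left sum.distrib[symmetric] D_def
    by (intro sum.cong) (auto simp: algebra_simps)
  ultimately show ?thesis by (simp add: c_def L_def Z_def)
qed

lemma hahn_lower:
  assumes q: "0 < q" "q < 1" and a: "\<And>j. 1 \<le> j \<Longrightarrow> j \<le> n \<Longrightarrow> a * q ^ j \<noteq> 1"
    and "X \<noteq> 0" "Y \<noteq> 0"
  shows "(1 - a * q * X) * hahn q n a b (q * X) Y + a * q * X * (1 - b * q * Y) * hahn q n a b X (q * Y)
    = (1 - a * b * q ^ (n + 2) * (X * Y)) / q ^ n * hahn q n a b X Y"
proof -
  let ?S = "\<lambda>X Y. \<Sum>k\<le>n. hahn_coeff q n a b k * hahn_mono q n k X Y"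
  have "(1 - a * q * X) * hahn q n a b (q * X) Y + a * q * X * (1 - b * q * Y) * hahn q n a b X (q * Y)
    = ((1 - a * q * X) * ?S (q * X) Y + a * q * X * (1 - b * q * Y) * ?S X (q * Y)) / (q ^ n * (X * Y) ^ n)"
    by (simp add: hahn_def power_mult_distrib add_divide_distrib mult_ac)
  also have "\<dots> = (1 - a * b * q ^ (n + 2) * (X * Y)) / q ^ n * hahn q n a b X Y"
    by (subst hahn_lower_sum) (use q a in \<open>simp_all add: hahn_def\<close>)
  finally show ?thesis .
qed

text \<open>If x < k, the first product of the monomial contains 1 - q^x/q^x; otherwise k \<le> x +
  y < n and the second product contains the zero factor at j = x + y. This vanishing later absorbs
  the case distinctions in \<open>xi\<close> and \<open>theta\<close>.\<close>

lemma hahn_eq_0: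
  assumes "q \<noteq> 0" "x + y < n"
  shows "hahn q n a b (q ^ x) (q ^ y) = 0"
proof -
  have "hahn_mono q n k (q ^ x) (q ^ y) = 0" for k
  proof (cases "x < k")
    case True
    then have "(\<Prod>j<k. 1 - q ^ x / q ^ j) = 0" using assms by (simp add: prod_one_minus_power_eq_0)
    then show ?thesis by (simp add: hahn_mono_def)
  next
    case False
    then have "(\<Prod>j=k..<n. 1 - q ^ x * q ^ y / q ^ j) = 0"
      using assms by (intro prod_zero bexI[of _ "x + y"]) (auto simp: power_add)
    then show ?thesis by (simp add: hahn_mono_def)
  qed
  then show ?thesis by (simp add: hahn_def)
qed

lemma hahn_one_left:
  "hahn q n a b 1 Y = (\<Prod>j<n. 1 - Y / q ^ j) / Y ^ n"
proof -
  have z: "hahn_mono q n (Suc k) 1 Y = 0" for k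
    by (simp add: hahn_mono_def prod.lessThan_Suc_shift del: prod.lessThan_Suc)
  have "(\<Sum>k\<le>n. hahn_coeff q n a b k * hahn_mono q n k 1 Y) = hahn_coeff q n a b 0 * hahn_mono q n 0 1 Y"
    by (simp add: sum.atMost_shift z)
  then show ?thesis
    by (simp add: hahn_def hahn_coeff_def hahn_mono_def lessThan_atLeast0)
qed

text \<open>At x + y = n - 1 the right-hand side of the lowering relation is 0, which leaves a
  two-term recurrence in x on the line x + y = n, starting from \<open>hahn_one_left\<close>. This
  takes the place of a q-Chu-Vandermonde summation.\<close>

lemma hahn_top:
  assumes q: "0 < q" "q < 1" and a: "\<And>j. 1 \<le> j \<Longrightarrow> j \<le> n \<Longrightarrow> a * q ^ j \<noteq> 1" and "x \<le> n"
  shows "hahn q n a b (q ^ x) (q ^ (n - x))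
    = qpoch q q n / q ^ (n * n) * (\<Prod>i<x. - (a * q ^ (i + 1)) * (1 - b * q ^ (n - i)) / (1 - a * q ^ (i + 1)))"
  using \<open>x \<le> n\<close>
proof (induction x)
  case 0
  have "(\<Prod>j<n. 1 - q ^ n / q ^ j) = qpoch q q n"
    using prod_one_minus_power_eq_qpoch[of q n n] q by simp
  then show ?case by (simp add: hahn_one_left power_mult)
next
  case (Suc x)
  define y where "y = n - Suc x"
  have y: "n - x = Suc y" "n - Suc x = y" using Suc.prems by (auto simp: y_def)
  have "(1 - a * q * q ^ x) * hahn q n a b (q * q ^ x) (q ^ y)
      + a * q * q ^ x * (1 - b * q * q ^ y) * hahn q n a b (q ^ x) (q * q ^ y) = 0"
    using hahn_eq_0[of q x y n a b] Suc.prems q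
    by (subst hahn_lower[OF q a]) (auto simp: y_def)
  moreover have "1 - a * q * q ^ x \<noteq> 0" using a[of "Suc x"] Suc.prems by (simp add: mult_ac)
  ultimately have "hahn q n a b (q * q ^ x) (q ^ y)
      = - (a * q * q ^ x) * (1 - b * q * q ^ y) / (1 - a * q * q ^ x) * hahn q n a b (q ^ x) (q * q ^ y)"
    by (simp add: field_simps)
  moreover have "hahn q n a b (q ^ x) (q * q ^ y) = qpoch q q n / q ^ (n * n)
      * (\<Prod>i<x. - (a * q ^ (i + 1)) * (1 - b * q ^ (n - i)) / (1 - a * q ^ (i + 1)))"
    using Suc.IH Suc.prems y by simp
  ultimately show ?case using y by (simp add: mult_ac)
qed

lemma hahn_eq_sum:
  assumes q: "0 < q" "q < 1" and le: "x \<le> M" "n \<le> M"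
  shows "hahn q n a b (q ^ x) (q ^ (M - x)) = qpoch q q M / (qpoch q q (M - n) * q ^ (M * n))
    * (\<Sum>k\<le>n. hahn_coeff q n a b k * (qpoch (q powi (- int x)) q k / qpoch (q powi (- int M)) q k))"
proof -
  have q0: "q \<noteq> 0" using q by simp
  have qn [simp]: "qpoch q q i \<noteq> 0" for i using qpoch_q_nonzero q by blast
  have Mn: "(\<Prod>j<k. 1 - q ^ M / q ^ j) \<noteq> 0" if "k \<le> M" for k
    using prod_one_minus_power_eq_qpoch[OF q0 that] qn[of M] by (metis mult_zero_right)
  have "hahn_mono q n k (q ^ x) (q ^ (M - x))
      = qpoch q q M / qpoch q q (M - n) * (qpoch (q powi (- int x)) q k / qpoch (q powi (- int M)) q k)"
    if k: "k \<le> n" for k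
  proof -
    have "(\<Prod>j<n. 1 - q ^ M / q ^ j) = (\<Prod>j<k. 1 - q ^ M / q ^ j) * (\<Prod>j=k..<n. 1 - q ^ M / q ^ j)"
      using k by (simp add: lessThan_atLeast0 prod.atLeastLessThan_concat)
    with prod_one_minus_power_eq_qpoch[OF q0 le(2)] have
      t: "(\<Prod>j=k..<n. 1 - q ^ M / q ^ j) = qpoch q q M / qpoch q q (M - n) / (\<Prod>j<k. 1 - q ^ M / q ^ j)"
      using Mn[of k] k le by (simp add: field_simps)
    have c: "(\<Prod>j<k. - (q ^ j)) \<noteq> 0" using q0 by simp
    have "q ^ M = q ^ x * q ^ (M - x)" using le by (simp flip: power_add)
    then have y: "(q ^ M) ^ k = (q ^ x) ^ k * (q ^ (M - x)) ^ k" by (simp add: power_mult_distrib)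
    have "qpoch (q powi (- int x)) q k / qpoch (q powi (- int M)) q k
        = (q ^ (M - x)) ^ k * (\<Prod>j<k. 1 - q ^ x / q ^ j) / (\<Prod>j<k. 1 - q ^ M / q ^ j)"
      using c q0 by (simp add: power_int_minus qpoch_inverse y)
    then show ?thesis
      using le by (simp add: hahn_mono_def t flip: power_add)
  qed
  then have "(\<Sum>k\<le>n. hahn_coeff q n a b k * hahn_mono q n k (q ^ x) (q ^ (M - x)))
     = qpoch q q M / qpoch q q (M - n)
       * (\<Sum>k\<le>n. hahn_coeff q n a b k * (qpoch (q powi (- int x)) q k / qpoch (q powi (- int M)) q k))"
    unfolding sum_distrib_left by (intro sum.cong) auto
  then show ?thesis
    using le by (simp add: hahn_def power_mult flip: power_add)
qed

lemma q_hahn_eq_hahn: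
  assumes q: "0 < q" "q < 1" and le: "x \<le> M" "n \<le> M"
  shows "q_hahn q n x a b M = q powr ((real n)\<^sup>2 / 2) * hahn q n a b (q ^ x) (q ^ (M - x))"
proof -
  have "q powr (- (real n * real M) + (real n)\<^sup>2 / 2) = q powr ((real n)\<^sup>2 / 2) / q ^ (M * n)"
  proof -
    have "- (real n * real M) + (real n)\<^sup>2 / 2 = (real n)\<^sup>2 / 2 - real (M * n)" by simp
    then show ?thesis using q by (simp only: powr_diff powr_realpow)
  qed
  moreover have "(\<Sum>k=0..n. (qpoch (q powi (- int n)) q k * qpoch (a * b * q ^ (n + 1)) q k
          * qpoch (q powi (- int x)) q k)
        / (qpoch (a * q) q k * qpoch (q powi (- int M)) q k * qpoch q q k) * q ^ k)
      = (\<Sum>k\<le>n. hahn_coeff q n a b k * (qpoch (q powi (- int x)) q k / qpoch (q powi (- int M)) q k))"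
    unfolding atMost_atLeast0 hahn_coeff_def by (intro sum.cong) (simp_all add: mult_ac)
  ultimately show ?thesis
    unfolding q_hahn_def hahn_eq_sum[OF q le] by (simp add: mult_ac)
qed

section \<open>Trees with three leaves\<close>

text \<open>The ranges are those of the denominators: (a q)_k and (b q)_k of the nodes, the
  parameter a b q^(2s+1) of the outer node together with the well-poised sum at A = a b q, and (a b
  c q^(M+2))_k of the q-Racah polynomial.\<close>

locale three_leaves =
  fixes q a b c :: real and M :: nat
  assumes q: "0 < q" "q < 1"
    and a: "\<And>j. 1 \<le> j \<Longrightarrow> j \<le> M \<Longrightarrow> a * q ^ j \<noteq> 1"
    and b: "\<And>j. 1 \<le> j \<Longrightarrow> j \<le> M \<Longrightarrow> b * q ^ j \<noteq> 1"
    and ab: "\<And>j. 2 \<le> j \<Longrightarrow> j \<le> 2 * M \<Longrightarrow> a * b * q ^ j \<noteq> 1"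
    and abc: "\<And>j. M + 2 \<le> j \<Longrightarrow> j \<le> 2 * M + 1 \<Longrightarrow> a * b * c * q ^ j \<noteq> 1"
begin

text \<open>The inner node of degree s enters the outer one as a single leaf with coordinate u + v -
  s, that is U V / q^s.\<close>

definition left_tree :: "nat \<Rightarrow> real \<Rightarrow> real \<Rightarrow> real \<Rightarrow> real" where
  "left_tree s U V W = hahn q s a b U V * hahn q (M - s) (a * b * q ^ (2 * s + 1)) c (U * V / q ^ s) W"

text \<open>The factor U^-m is the three-leaf form of the power q^(-j_k x_k) in
  \<open>xi\<close>.\<close>

definition right_tree :: "nat \<Rightarrow> real \<Rightarrow> real \<Rightarrow> real \<Rightarrow> real" where
  "right_tree m U V W
     = hahn q (M - m) a (b * c * q ^ (2 * m + 1)) U (V * W / q ^ m) * hahn q m b c V W / U ^ m"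

section \<open>The trees as eigenfunctions of the two operators\<close>

definition raise :: "(real \<Rightarrow> real \<Rightarrow> real \<Rightarrow> real) \<Rightarrow> real \<Rightarrow> real \<Rightarrow> real \<Rightarrow> real" where
  "raise f U V W = (1 - U) * f (U / q) V W + U * (1 - V) * f U (V / q) W + U * V * (1 - W) * f U V (W / q)"

definition lower :: "(real \<Rightarrow> real \<Rightarrow> real \<Rightarrow> real) \<Rightarrow> real \<Rightarrow> real \<Rightarrow> real \<Rightarrow> real" where
  "lower f U V W = (1 - a * q * U) * f (q * U) V W + a * q * U * (1 - b * q * V) * f U (q * V) W
     + a * b * q\<^sup>2 * U * V * (1 - c * q * W) * f U V (q * W)"

lemma q0 [simp]: "q \<noteq> 0" using q by simp

text \<open>The shifts of U and of V change the outer variable X = U V / q^s in the same way, so the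
  inner raising relation can be applied first. Its eigenvalue q^s - U V = q^s (1 - X) is the first
  coefficient of the outer raising relation times q^s.\<close>

lemma raise_left_tree:
  assumes "s \<le> M" "U \<noteq> 0" "V \<noteq> 0" "W \<noteq> 0"
  shows "raise (left_tree s) U V W = (q ^ M - U * V * W) * left_tree s U V W"
proof -
  define a' where "a' = a * b * q ^ (2 * s + 1)"
  define X where "X = U * V / q ^ s"
  have X: "X \<noteq> 0" using assms X_def by simp
  have e1: "U / q * V / q ^ s = X / q" "U * (V / q) / q ^ s = X / q" by (simp_all add: X_def)
  have t: "left_tree s (U / q) V W = hahn q s a b (U / q) V * hahn q (M - s) a' c (X / q) W"
    "left_tree s U (V / q) W = hahn q s a b U (V / q) * hahn q (M - s) a' c (X / q) W"
    "left_tree s U V (W / q) = hahn q s a b U V * hahn q (M - s) a' c X (W / q)"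
    by (simp_all only: left_tree_def a'_def e1) (simp only: X_def)
  have "raise (left_tree s) U V W
      = ((1 - U) * hahn q s a b (U / q) V + U * (1 - V) * hahn q s a b U (V / q)) * hahn q (M - s) a' c (X / q) W
        + U * V * (1 - W) * hahn q s a b U V * hahn q (M - s) a' c X (W / q)"
    by (simp only: raise_def t) (simp add: algebra_simps)
  also have "\<dots> = hahn q s a b U V * ((q ^ s - U * V) * hahn q (M - s) a' c (X / q) W
        + U * V * (1 - W) * hahn q (M - s) a' c X (W / q))"
    using assms by (subst hahn_raise) (auto simp: algebra_simps)
  also have "U * V = q ^ s * X" by (simp add: X_def)
  also have "(q ^ s - q ^ s * X) * hahn q (M - s) a' c (X / q) W + q ^ s * X * (1 - W) * hahn q (M - s) a' c X (W / q)
      = q ^ s * ((1 - X) * hahn q (M - s) a' c (X / q) W + X * (1 - W) * hahn q (M - s) a' c X (W / q))"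
    by (simp add: algebra_simps)
  also have "\<dots> = q ^ s * ((q ^ (M - s) - X * W) * hahn q (M - s) a' c X W)"
    using assms X by (subst hahn_raise) auto
  also have "hahn q s a b U V * \<dots> = (q ^ s * q ^ (M - s) - q ^ s * X * W) * left_tree s U V W"
    by (simp add: left_tree_def a'_def X_def algebra_simps)
  finally show ?thesis using assms by (simp add: X_def flip: power_add)
qed

text \<open>The inner eigenvalue is q^m (1 - Y); the shift of U in U^-m supplies the same factor q^m
  to the remaining term, so that the outer raising relation applies.\<close>

lemma raise_right_tree:
  assumes "m \<le> M" "U \<noteq> 0" "V \<noteq> 0" "W \<noteq> 0"
  shows "raise (right_tree m) U V W = (q ^ M - U * V * W) * right_tree m U V W"
proof -
  define b' where "b' = b * c * q ^ (2 * m + 1)"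
  define Y where "Y = V * W / q ^ m"
  have Y: "Y \<noteq> 0" using assms Y_def by simp
  have e1: "V / q * W / q ^ m = Y / q" "V * (W / q) / q ^ m = Y / q" by (simp_all add: Y_def)
  have t: "right_tree m (U / q) V W = hahn q (M - m) a b' (U / q) Y * q ^ m * hahn q m b c V W / U ^ m"
    "right_tree m U (V / q) W = hahn q (M - m) a b' U (Y / q) * hahn q m b c (V / q) W / U ^ m"
    "right_tree m U V (W / q) = hahn q (M - m) a b' U (Y / q) * hahn q m b c V (W / q) / U ^ m"
    by (simp_all only: right_tree_def b'_def e1) (simp add: Y_def power_divide)
  have "raise (right_tree m) U V W
      = ((1 - U) * hahn q (M - m) a b' (U / q) Y * q ^ m * hahn q m b c V W
        + U * hahn q (M - m) a b' U (Y / q)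
          * ((1 - V) * hahn q m b c (V / q) W + V * (1 - W) * hahn q m b c V (W / q))) / U ^ m"
    by (simp only: raise_def t) (simp add: add_divide_distrib distrib_left mult_ac)
  also have "(1 - V) * hahn q m b c (V / q) W + V * (1 - W) * hahn q m b c V (W / q)
      = (q ^ m - V * W) * hahn q m b c V W"
    using assms by (subst hahn_raise) auto
  also have "V * W = q ^ m * Y" by (simp add: Y_def)
  also have "(1 - U) * hahn q (M - m) a b' (U / q) Y * q ^ m * hahn q m b c V W
        + U * hahn q (M - m) a b' U (Y / q) * ((q ^ m - q ^ m * Y) * hahn q m b c V W)
      = q ^ m * hahn q m b c V W
        * ((1 - U) * hahn q (M - m) a b' (U / q) Y + U * (1 - Y) * hahn q (M - m) a b' U (Y / q))"
    by (simp add: algebra_simps)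
  also have "\<dots> = q ^ m * hahn q m b c V W * ((q ^ (M - m) - U * Y) * hahn q (M - m) a b' U Y)"
    using assms Y by (subst hahn_raise) auto
  also have "\<dots> / U ^ m = (q ^ m * q ^ (M - m) - q ^ m * U * Y) * right_tree m U V W"
    by (simp add: right_tree_def b'_def Y_def algebra_simps)
  finally show ?thesis using assms by (simp add: Y_def mult_ac flip: power_add)
qed

text \<open>The inner eigenvalue is (1 - a b q^(s+2) U V) / q^s = (1 - a' q X) / q^s, which matches
  the first coefficient of the outer lowering relation precisely for a' = a b q^(2s+1).\<close>

lemma lower_left_tree:
  assumes "s \<le> M" "U \<noteq> 0" "V \<noteq> 0" "W \<noteq> 0"
  shows "lower (left_tree s) U V W = (1 - a * b * c * q ^ (M + 3) * (U * V * W)) / q ^ M * left_tree s U V W"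
proof -
  define a' where "a' = a * b * q ^ (2 * s + 1)"
  define X where "X = U * V / q ^ s"
  have X: "X \<noteq> 0" using assms X_def by simp
  have a': "a' * q ^ j \<noteq> 1" if "1 \<le> j" "j \<le> M - s" for j
    using ab[of "2 * s + 1 + j"] that assms by (simp add: a'_def power_add mult_ac)
  have e1: "q * U * V / q ^ s = q * X" "U * (q * V) / q ^ s = q * X" by (simp_all add: X_def)
  have t: "left_tree s (q * U) V W = hahn q s a b (q * U) V * hahn q (M - s) a' c (q * X) W"
    "left_tree s U (q * V) W = hahn q s a b U (q * V) * hahn q (M - s) a' c (q * X) W"
    "left_tree s U V (q * W) = hahn q s a b U V * hahn q (M - s) a' c X (q * W)"
    by (simp_all only: left_tree_def a'_def e1) (simp only: X_def)
  have "lower (left_tree s) U V W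
      = ((1 - a * q * U) * hahn q s a b (q * U) V + a * q * U * (1 - b * q * V) * hahn q s a b U (q * V))
         * hahn q (M - s) a' c (q * X) W
        + a * b * q\<^sup>2 * U * V * (1 - c * q * W) * hahn q s a b U V * hahn q (M - s) a' c X (q * W)"
    by (simp only: lower_def t) (simp add: algebra_simps)
  also have "(1 - a * q * U) * hahn q s a b (q * U) V + a * q * U * (1 - b * q * V) * hahn q s a b U (q * V)
      = (1 - a * b * q ^ (s + 2) * (U * V)) / q ^ s * hahn q s a b U V"
    using assms a by (intro hahn_lower q) auto
  also have "U * V = q ^ s * X" by (simp add: X_def)
  also have "a * b * q\<^sup>2 * U * V = a' * q * X / q ^ s"
    by (simp add: X_def a'_def power_add mult_2 power2_eq_square)
  also have "a * b * q ^ (s + 2) * (q ^ s * X) = a' * q * X"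
    by (simp add: a'_def power_add mult_2 power2_eq_square)
  also have "(1 - a' * q * X) / q ^ s * hahn q s a b U V * hahn q (M - s) a' c (q * X) W
        + a' * q * X / q ^ s * (1 - c * q * W) * hahn q s a b U V * hahn q (M - s) a' c X (q * W)
      = hahn q s a b U V / q ^ s * ((1 - a' * q * X) * hahn q (M - s) a' c (q * X) W
        + a' * q * X * (1 - c * q * W) * hahn q (M - s) a' c X (q * W))"
    by (simp add: distrib_left mult_ac)
  also have "(1 - a' * q * X) * hahn q (M - s) a' c (q * X) W
        + a' * q * X * (1 - c * q * W) * hahn q (M - s) a' c X (q * W)
      = (1 - a' * c * q ^ (M - s + 2) * (X * W)) / q ^ (M - s) * hahn q (M - s) a' c X W"
    using assms a' X by (intro hahn_lower q) auto
  also have "a' * c * q ^ (M - s + 2) * (X * W) = a * b * c * q ^ (M + 3) * (U * V * W)"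
  proof -
    have "2 * s + 1 + (M - s + 2) = M + 3 + s" using assms by simp
    then have "q ^ (2 * s + 1) * q ^ (M - s + 2) = q ^ (M + 3) * q ^ s"
      by (metis power_add)
    then have "a * b * c * (q ^ (2 * s + 1) * q ^ (M - s + 2)) * (X * W)
        = a * b * c * (q ^ (M + 3) * q ^ s) * (X * W)" by simp
    then show ?thesis by (simp add: a'_def X_def mult_ac)
  qed
  also have "hahn q s a b U V / q ^ s * ((1 - a * b * c * q ^ (M + 3) * (U * V * W)) / q ^ (M - s) * hahn q (M - s) a' c X W)
      = (1 - a * b * c * q ^ (M + 3) * (U * V * W)) / (q ^ s * q ^ (M - s)) * left_tree s U V W"
    by (simp add: left_tree_def a'_def X_def)
  also have "q ^ s * q ^ (M - s) = q ^ M" using assms by (simp flip: power_add)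
  finally show ?thesis .
qed

lemma lower_right_tree:
  assumes "m \<le> M" "U \<noteq> 0" "V \<noteq> 0" "W \<noteq> 0"
  shows "lower (right_tree m) U V W = (1 - a * b * c * q ^ (M + 3) * (U * V * W)) / q ^ M * right_tree m U V W"
proof -
  define b' where "b' = b * c * q ^ (2 * m + 1)"
  define Y where "Y = V * W / q ^ m"
  have Y: "Y \<noteq> 0" using assms Y_def by simp
  have e1: "q * V * W / q ^ m = q * Y" "V * (q * W) / q ^ m = q * Y" by (simp_all add: Y_def)
  define H where "H = hahn q m b c V W / (U ^ m * q ^ m)"
  have t: "right_tree m (q * U) V W = hahn q (M - m) a b' (q * U) Y * H"
    "right_tree m U (q * V) W = hahn q (M - m) a b' U (q * Y) * hahn q m b c (q * V) W / U ^ m"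
    "right_tree m U V (q * W) = hahn q (M - m) a b' U (q * Y) * hahn q m b c V (q * W) / U ^ m"
    by (simp_all only: right_tree_def b'_def e1) (simp add: Y_def power_mult_distrib H_def mult_ac)
  have "lower (right_tree m) U V W
      = (1 - a * q * U) * hahn q (M - m) a b' (q * U) Y * H
        + a * q * U * hahn q (M - m) a b' U (q * Y) / U ^ m
          * ((1 - b * q * V) * hahn q m b c (q * V) W + b * q * V * (1 - c * q * W) * hahn q m b c V (q * W))"
    by (simp only: lower_def t) (simp add: add_divide_distrib distrib_left power2_eq_square mult_ac)
  also have "(1 - b * q * V) * hahn q m b c (q * V) W + b * q * V * (1 - c * q * W) * hahn q m b c V (q * W)
      = (1 - b * c * q ^ (m + 2) * (V * W)) / q ^ m * hahn q m b c V W"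
    using assms b by (intro hahn_lower q) auto
  also have "b * c * q ^ (m + 2) * (V * W) = b' * q * Y"
    by (simp add: b'_def Y_def power_add mult_2 power2_eq_square)
  also have "(1 - a * q * U) * hahn q (M - m) a b' (q * U) Y * H
        + a * q * U * hahn q (M - m) a b' U (q * Y) / U ^ m * ((1 - b' * q * Y) / q ^ m * hahn q m b c V W)
      = H * ((1 - a * q * U) * hahn q (M - m) a b' (q * U) Y
        + a * q * U * (1 - b' * q * Y) * hahn q (M - m) a b' U (q * Y))"
    by (simp add: H_def distrib_left mult_ac)
  also have "(1 - a * q * U) * hahn q (M - m) a b' (q * U) Y
        + a * q * U * (1 - b' * q * Y) * hahn q (M - m) a b' U (q * Y)
      = (1 - a * b' * q ^ (M - m + 2) * (U * Y)) / q ^ (M - m) * hahn q (M - m) a b' U Y"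
    using assms a Y by (intro hahn_lower q) auto
  also have "a * b' * q ^ (M - m + 2) * (U * Y) = a * b * c * q ^ (M + 3) * (U * V * W)"
  proof -
    have "2 * m + 1 + (M - m + 2) = M + 3 + m" using assms by simp
    then have "q ^ (2 * m + 1) * q ^ (M - m + 2) = q ^ (M + 3) * q ^ m"
      by (metis power_add)
    then have "a * b * c * (q ^ (2 * m + 1) * q ^ (M - m + 2)) * (U * Y)
        = a * b * c * (q ^ (M + 3) * q ^ m) * (U * Y)" by simp
    then show ?thesis by (simp add: b'_def Y_def mult_ac)
  qed
  also have "H * ((1 - a * b * c * q ^ (M + 3) * (U * V * W)) / q ^ (M - m) * hahn q (M - m) a b' U Y)
      = (1 - a * b * c * q ^ (M + 3) * (U * V * W)) / (q ^ m * q ^ (M - m)) * right_tree m U V W"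
    by (simp add: right_tree_def H_def b'_def Y_def mult_ac)
  also have "q ^ m * q ^ (M - m) = q ^ M" using assms by (simp flip: power_add)
  finally show ?thesis .
qed

section \<open>Vanishing below total degree, uniqueness, and values at u = 0\<close>

lemma left_tree_eq_0:
  assumes "u + v + w < M"
  shows "left_tree s (q ^ u) (q ^ v) (q ^ w) = 0"
proof (cases "u + v < s")
  case True
  then show ?thesis by (simp add: left_tree_def hahn_eq_0)
next
  case False
  then have "q ^ u * q ^ v / q ^ s = q ^ (u + v - s)" by (simp add: power_diff power_add)
  then show ?thesis using False assms by (simp add: left_tree_def hahn_eq_0)
qed

lemma right_tree_eq_0:
  assumes "u + v + w < M"
  shows "right_tree m (q ^ u) (q ^ v) (q ^ w) = 0"
proof (cases "v + w < m")
  case True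
  then show ?thesis by (simp add: right_tree_def hahn_eq_0)
next
  case False
  then have "q ^ v * q ^ w / q ^ m = q ^ (v + w - m)" by (simp add: power_diff power_add)
  then show ?thesis using False assms by (simp add: right_tree_def hahn_eq_0)
qed

text \<open>Applied at u + v + w = M - 1, where F vanishes, the lowering relation expresses F at u +
  1 through values at u, so it carries zeros from u = 0 to the whole level M; the eigenvalue
  \<open>k\<close> is therefore arbitrary. Above level M the raising relation determines each level
  from the previous one, because q^M - q^(u+v+w) is nonzero there.\<close>

lemma tree_unique:
  assumes raise: "\<And>U V W. U \<noteq> 0 \<Longrightarrow> V \<noteq> 0 \<Longrightarrow> W \<noteq> 0 \<Longrightarrow> raise F U V W = (q ^ M - U * V * W) * F U V W"
    and lower: "\<And>U V W. U \<noteq> 0 \<Longrightarrow> V \<noteq> 0 \<Longrightarrow> W \<noteq> 0 \<Longrightarrow> lower F U V W = k U V W * F U V W"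
    and zero: "\<And>u v w. u + v + w < M \<Longrightarrow> F (q ^ u) (q ^ v) (q ^ w) = 0"
    and init: "\<And>v w. v + w = M \<Longrightarrow> F 1 (q ^ v) (q ^ w) = 0"
  shows "F (q ^ u) (q ^ v) (q ^ w) = 0"
proof -
  have top: "F (q ^ u) (q ^ v) (q ^ w) = 0" if "u + v + w = M" for u v w
    using that
  proof (induction u arbitrary: v w)
    case 0
    then show ?case using init by simp
  next
    case (Suc u)
    have "F (q ^ u) (q * q ^ v) (q ^ w) = 0" "F (q ^ u) (q ^ v) (q * q ^ w) = 0"
      using Suc.IH[of "Suc v" w] Suc.IH[of v "Suc w"] Suc.prems by simp_all
    moreover have "F (q ^ u) (q ^ v) (q ^ w) = 0" using zero Suc.prems by simp
    ultimately have "(1 - a * q * q ^ u) * F (q * q ^ u) (q ^ v) (q ^ w) = 0"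
      using lower[of "q ^ u" "q ^ v" "q ^ w"] by (simp add: lower_def)
    moreover have "1 - a * q * q ^ u \<noteq> 0" using a[of "Suc u"] Suc.prems by (simp add: mult_ac)
    ultimately show ?case by simp
  qed
  have "F (q ^ u) (q ^ v) (q ^ w) = 0" if "u + v + w = M + d" for d u v w
    using that
  proof (induction d arbitrary: u v w)
    case 0
    then show ?case using top by simp
  next
    case (Suc d)
    \<comment> \<open>At u = 0 the argument q^u / q leaves the grid, but its coefficient 1 - q^0 is
      0; likewise for v and w.\<close>
    have 1: "(1 - q ^ u) * F (q ^ u / q) (q ^ v) (q ^ w) = 0"
      using Suc.IH[of "u - 1" v w] Suc.prems by (cases u) auto
    have 2: "(1 - q ^ v) * F (q ^ u) (q ^ v / q) (q ^ w) = 0"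
      using Suc.IH[of u "v - 1" w] Suc.prems by (cases v) auto
    have 3: "(1 - q ^ w) * F (q ^ u) (q ^ v) (q ^ w / q) = 0"
      using Suc.IH[of u v "w - 1"] Suc.prems by (cases w) auto
    have "raise F (q ^ u) (q ^ v) (q ^ w) = 0"
      unfolding raise_def mult.assoc 1 2 3 by simp
    then have "(q ^ M - q ^ u * q ^ v * q ^ w) * F (q ^ u) (q ^ v) (q ^ w) = 0"
      using raise[of "q ^ u" "q ^ v" "q ^ w"] by simp
    moreover have "q ^ u * q ^ v * q ^ w < q ^ M"
    proof -
      have "q ^ (u + v + w) < q ^ M" using Suc.prems q by (intro power_strict_decreasing) auto
      then show ?thesis by (simp add: power_add)
    qed
    ultimately show ?case by simp
  qed
  then show ?thesis
    using zero[of u v w] by (cases "u + v + w < M") (auto simp: not_less le_iff_add)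
qed

text \<open>The factor through which m enters both sides: the coefficient of (q^-v)_k in the right
  tree at u = 0 and, apart from 1 / (g)_k, of (q^-s)_k (A q^s)_k in the q-Racah sum.\<close>

definition racah_part :: "nat \<Rightarrow> nat \<Rightarrow> real" where
  "racah_part m k = qpoch (q powi (- int m)) q k * qpoch (b * c * q ^ (m + 1)) q k * q ^ k
     / (qpoch (b * q) q k * qpoch (q powi (- int M)) q k * qpoch q q k)"

lemma qpoch_neg_eq_0: "s < k \<Longrightarrow> qpoch (q powi (- int s)) q k = 0"
  using qpoch_inverse[of "q ^ s" q k] by (simp add: power_int_minus prod_one_minus_power_eq_0)

text \<open>At U = 1 and v + w = M the outer node sits at top degree with first argument 1, hence is
  a constant; only the inner q-Hahn sum still depends on v. Its range extends to M since (q^-m)_k =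
  0 for k > m.\<close>

lemma right_tree_init:
  assumes "m \<le> M" "v + w = M"
  shows "right_tree m 1 (q ^ v) (q ^ w) / q ^ (m * (M - m))
    = qpoch q q M / q ^ (M * M) * (\<Sum>k\<le>M. racah_part m k * qpoch (q powi (- int v)) q k)"
proof -
  have w: "w = M - v" "v \<le> M" using assms by auto
  have qn [simp]: "qpoch q q i \<noteq> 0" for i using qpoch_q_nonzero q by blast
  have e: "q ^ v * q ^ w / q ^ m = q ^ (M - m)" using assms by (simp add: power_diff flip: power_add)
  have h1: "hahn q (M - m) a (b * c * q ^ (2 * m + 1)) 1 (q ^ (M - m)) = qpoch q q (M - m) / q ^ ((M - m) * (M - m))"
    using hahn_top[of q "M - m" a 0] q a by simp
  have "(\<Sum>k\<le>M. racah_part m k * qpoch (q powi (- int v)) q k)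
      = (\<Sum>k\<le>m. racah_part m k * qpoch (q powi (- int v)) q k)"
    using assms by (intro sum.mono_neutral_right) (auto simp: racah_part_def qpoch_neg_eq_0)
  also have "\<dots> = (\<Sum>k\<le>m. hahn_coeff q m b c k * (qpoch (q powi (- int v)) q k / qpoch (q powi (- int M)) q k))"
    by (intro sum.cong) (auto simp: racah_part_def hahn_coeff_def mult_ac)
  finally have h2: "hahn q m b c (q ^ v) (q ^ w) = qpoch q q M / (qpoch q q (M - m) * q ^ (M * m))
      * (\<Sum>k\<le>M. racah_part m k * qpoch (q powi (- int v)) q k)"
    unfolding w(1) hahn_eq_sum[OF q w(2) assms(1)] by simp
  obtain d where d: "M = m + d" using assms le_iff_add by auto
  have "q ^ (M * M) = q ^ ((M - m) * (M - m)) * q ^ (M * m) * q ^ (m * (M - m))"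
    unfolding d by (simp add: algebra_simps flip: power_add)
  then show ?thesis unfolding right_tree_def e h1 h2 by simp
qed

text \<open>Here both nodes are products: the inner one has first argument 1, the outer one
  satisfies (v - s) + w = M - s and is of top degree. Together with the prefactor of the q-Racah
  polynomial they form exactly one term of the well-poised sum.\<close>

lemma left_tree_init:
  assumes "s \<le> M" "v + w = M"
  shows "q_racah q s m b a (b * c * q ^ (M + 1)) M / q ^ (s * (M - s)) * left_tree s 1 (q ^ v) (q ^ w)
    = (if s \<le> v then qpoch q q M / q ^ (M * M) * wp_term q (a * b * q) (a * b * c * q ^ (M + 2)) v s
         * (\<Sum>k\<le>M. racah_part m k / qpoch (a * b * c * q ^ (M + 2)) q k
              * (qpoch (q powi (- int s)) q k * qpoch (a * b * q * q ^ s) q k))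
       else 0)"
proof (cases "s \<le> v")
  case False
  then have "hahn q s a b 1 (q ^ v) = 0" using hahn_eq_0[of q 0 v s] by simp
  with False show ?thesis by (simp add: left_tree_def)
next
  case True
  have w: "w = (M - s) - (v - s)" "v - s \<le> M - s" using assms True by auto
  have qn [simp]: "qpoch q q i \<noteq> 0" for i using qpoch_q_nonzero q by blast
  define A g where "A = a * b * q" and "g = a * b * c * q ^ (M + 2)"
  define S where "S = (\<Sum>k\<le>M. racah_part m k / qpoch g q k * (qpoch (q powi (- int s)) q k * qpoch (A * q ^ s) q k))"
  define a' where "a' = a * b * q ^ (2 * s + 1)"
  have a': "a' * q ^ j \<noteq> 1" if "1 \<le> j" "j \<le> M - s" for j
    using ab[of "2 * s + 1 + j"] that assms by (simp add: a'_def power_add mult_ac)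
  have e: "1 * q ^ v / q ^ s = q ^ (v - s)" using True by (simp add: power_diff)
  have h1: "hahn q s a b 1 (q ^ v) = qpoch q q v / qpoch q q (v - s) / q ^ (v * s)"
    unfolding prod_one_minus_power_eq_qpoch[OF q0 True, symmetric] by (simp add: hahn_one_left power_mult)
  define P where "P = (\<Prod>i<v - s. (g - A * q ^ (s + i + 1)) / (1 - A * q ^ (2 * s + i + 1)))"
  \<comment> \<open>This is the origin of A and g: a' q^(i+1) = q^s A q^(s+i+1), and multiplying it
    by c q^(M-s-i) gives q^s g, independently of i.\<close>
  have "(\<Prod>i<v - s. - (a' * q ^ (i + 1)) * (1 - c * q ^ (M - s - i)) / (1 - a' * q ^ (i + 1)))
     = (\<Prod>i<v - s. q ^ s * ((g - A * q ^ (s + i + 1)) / (1 - A * q ^ (2 * s + i + 1))))"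
  proof (intro prod.cong refl)
    fix i assume "i \<in> {..<v - s}"
    then have "q ^ M = q ^ s * q ^ i * q ^ (M - s - i)" using assms by (simp flip: power_add)
    then show "- (a' * q ^ (i + 1)) * (1 - c * q ^ (M - s - i)) / (1 - a' * q ^ (i + 1))
      = q ^ s * ((g - A * q ^ (s + i + 1)) / (1 - A * q ^ (2 * s + i + 1)))"
      by (simp add: a'_def A_def g_def power_add mult_2 mult_2_right algebra_simps)
  qed
  also have "\<dots> = (q ^ s) ^ (v - s) * P" by (simp only: prod.distrib prod_constant card_lessThan P_def)
  finally have h2: "hahn q (M - s) a' c (q ^ (v - s)) (q ^ w)
      = qpoch q q (M - s) / q ^ ((M - s) * (M - s)) * (q ^ (s * (v - s)) * P)"
    unfolding w(1) using hahn_top[OF q a' w(2)] by (simp add: power_mult)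
  have lt: "left_tree s 1 (q ^ v) (q ^ w) = qpoch q q v / qpoch q q (v - s) / q ^ (v * s)
     * (qpoch q q (M - s) / q ^ ((M - s) * (M - s)) * (q ^ (s * (v - s)) * P))"
    unfolding left_tree_def e a'_def[symmetric] h1 h2 ..
  have r1: "qpoch (q powi (int M - int s + 1)) q s = qpoch q q M / qpoch q q (M - s)"
  proof -
    have "int M - int s + 1 = int (M - s + 1)" using assms by simp
    then have "q powi (int M - int s + 1) = q * q ^ (M - s)"
      by (simp only: power_int_of_nat) simp
    moreover have "qpoch q q M = qpoch q q (M - s) * qpoch (q * q ^ (M - s)) q s"
      using qpoch_add[of q q "M - s" s] assms by simp
    ultimately show ?thesis by simp
  qed
  have r2: "q powi (- (int s * (int M - int s))) = 1 / q ^ (s * (M - s))"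
    using assms by (simp add: power_int_minus divide_inverse flip: of_nat_diff of_nat_mult power_int_of_nat)
  have r3: "(\<Sum>k=0..s. (qpoch (q powi (- int s)) q k * qpoch (b * c * q ^ (M + 1) * q powi (int m - int M)) q k
          * qpoch (q powi (- int m)) q k * qpoch (b * a * q ^ (s + 1)) q k)
        / (qpoch (b * q) q k * qpoch (a * (b * c * q ^ (M + 1)) * q) q k
            * qpoch (q powi (- int M)) q k * qpoch q q k) * q ^ k) = S"
  proof -
    have "q powi (int m - int M) = q ^ m / q ^ M" by (simp add: power_int_diff)
    then have "b * c * q ^ (M + 1) * q powi (int m - int M) = b * c * q ^ (m + 1)" by simp
    moreover have "a * (b * c * q ^ (M + 1)) * q = g" "b * a * q ^ (s + 1) = A * q ^ s"
      by (simp_all add: g_def A_def)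
    moreover have "S = (\<Sum>k\<le>s. racah_part m k / qpoch g q k * (qpoch (q powi (- int s)) q k * qpoch (A * q ^ s) q k))"
      unfolding S_def using assms by (intro sum.mono_neutral_right) (auto simp: qpoch_neg_eq_0)
    ultimately show ?thesis
      unfolding atMost_atLeast0 by (simp only:) (intro sum.cong refl, simp add: racah_part_def mult_ac)
  qed
  have ra: "q_racah q s m b a (b * c * q ^ (M + 1)) M
     = 1 / q ^ (s * (M - s)) * ((qpoch g q s * (qpoch q q M / qpoch q q (M - s))) / (qpoch (A * q ^ s) q s * qpoch q q s)) * S"
    unfolding q_racah_def r1 r2 r3
    by (simp add: g_def A_def mult_ac)
  obtain d where d: "M = s + d" using assms le_iff_add by auto
  obtain t where t: "v = s + t" using True le_iff_add by auto
  have "q ^ (M * M) * q ^ (s * (v - s)) = q ^ (s * (M - s)) * q ^ (s * (M - s)) * q ^ ((M - s) * (M - s)) * q ^ (v * s)"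
    unfolding d t by (simp add: algebra_simps flip: power_add)
  then have p: "q ^ (s * (v - s)) = q ^ (s * (M - s)) * q ^ (s * (M - s)) * q ^ ((M - s) * (M - s)) * q ^ (v * s) / q ^ (M * M)"
    by (simp add: field_simps)
  have "q_racah q s m b a (b * c * q ^ (M + 1)) M / q ^ (s * (M - s)) * left_tree s 1 (q ^ v) (q ^ w)
      = qpoch q q M / q ^ (M * M) * wp_term q A g v s * S"
    unfolding ra lt wp_term_def P_def[symmetric] p by (simp add: mult_ac)
  then show ?thesis using True by (simp add: A_def g_def S_def)
qed

text \<open>The powers q^(m(M-m)) and q^(s(M-s)) stand for the factors q^(n^2/2) of the q-Hahn
  polynomials, which \<open>hahn\<close> omits.\<close>

theorem right_tree_expansion:
  assumes m: "m \<le> M"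
  shows "right_tree m (q ^ u) (q ^ v) (q ^ w) / q ^ (m * (M - m))
    = (\<Sum>s\<le>M. q_racah q s m b a (b * c * q ^ (M + 1)) M / q ^ (s * (M - s)) * left_tree s (q ^ u) (q ^ v) (q ^ w))"
proof -
  define r where "r s = q_racah q s m b a (b * c * q ^ (M + 1)) M / q ^ (s * (M - s))" for s
  define F where "F U V W = right_tree m U V W / q ^ (m * (M - m)) - (\<Sum>s\<le>M. r s * left_tree s U V W)" for U V W
  have rF: "raise F U V W = raise (right_tree m) U V W / q ^ (m * (M - m)) - (\<Sum>s\<le>M. r s * raise (left_tree s) U V W)" for U V W
    unfolding raise_def F_def
    by (simp add: sum_distrib_left sum.distrib sum_subtractf algebra_simps add_divide_distrib diff_divide_distrib)
  have lF: "lower F U V W = lower (right_tree m) U V W / q ^ (m * (M - m)) - (\<Sum>s\<le>M. r s * lower (left_tree s) U V W)" for U V W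
    unfolding lower_def F_def
    by (simp add: sum_distrib_left sum.distrib sum_subtractf algebra_simps add_divide_distrib diff_divide_distrib)
  have "F (q ^ u) (q ^ v) (q ^ w) = 0"
  proof (rule tree_unique)
    fix U V W :: real assume nz: "U \<noteq> 0" "V \<noteq> 0" "W \<noteq> 0"
    show "raise F U V W = (q ^ M - U * V * W) * F U V W"
      unfolding rF F_def using raise_right_tree[OF m nz] raise_left_tree[OF _ nz]
      by (simp add: right_diff_distrib sum_distrib_left mult_ac)
    define K where "K = (1 - a * b * c * q ^ (M + 3) * (U * V * W)) / q ^ M"
    have "(\<Sum>s\<le>M. r s * lower (left_tree s) U V W) = K * (\<Sum>s\<le>M. r s * left_tree s U V W)"
      unfolding sum_distrib_left K_def
      by (intro sum.cong refl) (simp add: lower_left_tree[OF _ nz])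
    then show "lower F U V W = (1 - a * b * c * q ^ (M + 3) * (U * V * W)) / q ^ M * F U V W"
      unfolding lF F_def lower_right_tree[OF m nz] K_def[symmetric]
      by (simp add: right_diff_distrib)
  next
    fix u v w :: nat assume "u + v + w < M"
    then show "F (q ^ u) (q ^ v) (q ^ w) = 0"
      by (simp add: F_def right_tree_eq_0 left_tree_eq_0)
  next
    fix v w :: nat assume vw: "v + w = M"
    define A g where "A = a * b * q" and "g = a * b * c * q ^ (M + 2)"
    let ?t = "\<lambda>s k. qpoch (q powi (- int s)) q k * qpoch (A * q ^ s) q k"
    have g: "qpoch g q k \<noteq> 0" if "k \<le> M" for k
    proof (rule qpoch_nonzero)
      fix j assume "j < k"
      then show "g * q ^ j \<noteq> 1" using abc[of "M + 2 + j"] that by (simp add: g_def power_add mult_ac)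
    qed
    have A: "A * q ^ j \<noteq> 1" if "1 \<le> j" "j < 2 * v" for j
      using ab[of "Suc j"] that vw by (simp add: A_def mult_ac)
    define f where "f s = qpoch q q M / q ^ (M * M) * wp_term q A g v s
      * (\<Sum>k\<le>M. racah_part m k / qpoch g q k * ?t s k)" for s
    have "(\<Sum>s\<le>M. r s * left_tree s 1 (q ^ v) (q ^ w)) = (\<Sum>s\<le>M. if s \<le> v then f s else 0)"
      unfolding r_def f_def A_def g_def using vw
      by (intro sum.cong refl) (simp only: left_tree_init atMost_iff)
    also have "\<dots> = (\<Sum>s\<le>v. f s)"
      using vw by (intro sum.mono_neutral_cong_right) auto
    also have "\<dots> = qpoch q q M / q ^ (M * M) * (\<Sum>s\<le>v. \<Sum>k\<le>M. racah_part m k / qpoch g q k * (wp_term q A g v s * ?t s k))"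
      by (simp add: f_def sum_distrib_left mult_ac)
    \<comment> \<open>With k outside, the inner sum over s is \<open>wp_sum_shift\<close>; the
      factor (g)_k it produces cancels the denominator, leaving the value of the right tree.\<close>
    also have "\<dots> = qpoch q q M / q ^ (M * M) * (\<Sum>k\<le>M. racah_part m k / qpoch g q k * (\<Sum>s\<le>v. wp_term q A g v s * ?t s k))"
      by (subst sum.swap) (simp add: sum_distrib_left)
    also have "\<dots> = qpoch q q M / q ^ (M * M) * (\<Sum>k\<le>M. racah_part m k * qpoch (q powi (- int v)) q k)"
      using g by (simp add: wp_sum_shift[OF q A])
    finally show "F 1 (q ^ v) (q ^ w) = 0"
      unfolding F_def right_tree_init[OF m vw] by simp
  qed
  then show ?thesis by (simp add: F_def r_def)
qed

end

section \<open>Rotating the right comb into the left comb\<close>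

lemma powi_eq_power: "z = int e \<Longrightarrow> (q::real) powi z = q ^ e"
  by simp

text \<open>A q-Hahn polynomial with its normalization, but also meaningful outside the range of
  \<open>q_hahn\<close>, where truncated subtraction would distort it.\<close>

definition hahn_node :: "real \<Rightarrow> nat \<Rightarrow> real \<Rightarrow> real \<Rightarrow> real \<Rightarrow> real \<Rightarrow> real" where
  "hahn_node q n a b X Y = q powr ((real n)\<^sup>2 / 2) * hahn q n a b X Y"

lemma (in three_leaves) node_rotation:
  assumes m: "m \<le> M"
  shows "hahn_node q (M - m) a (b * c * q ^ (2 * m + 1)) (q ^ u) (q ^ v * q ^ w / q ^ m)
      * hahn_node q m b c (q ^ v) (q ^ w) / (q ^ u) ^ m
    = (\<Sum>s\<le>M. q_racah q s m b a (b * c * q ^ (M + 1)) M * (hahn_node q s a b (q ^ u) (q ^ v)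
        * hahn_node q (M - s) (a * b * q ^ (2 * s + 1)) c (q ^ u * q ^ v / q ^ s) (q ^ w)))"
proof -
  have p: "q powr ((real (M - s))\<^sup>2 / 2) * q powr ((real s)\<^sup>2 / 2) = q powr ((real M)\<^sup>2 / 2) / q ^ (s * (M - s))"
    if "s \<le> M" for s
  proof -
    have "(real (M - s))\<^sup>2 / 2 + (real s)\<^sup>2 / 2 = (real M)\<^sup>2 / 2 - real (s * (M - s))"
      using that by (simp add: of_nat_diff power2_eq_square field_simps)
    then show ?thesis
      using q by (simp only: powr_add[symmetric] powr_diff powr_realpow)
  qed
  have "hahn_node q (M - m) a (b * c * q ^ (2 * m + 1)) (q ^ u) (q ^ v * q ^ w / q ^ m)
      * hahn_node q m b c (q ^ v) (q ^ w) / (q ^ u) ^ m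
      = q powr ((real (M - m))\<^sup>2 / 2) * q powr ((real m)\<^sup>2 / 2) * right_tree m (q ^ u) (q ^ v) (q ^ w)"
    by (simp add: hahn_node_def right_tree_def)
  also have "\<dots> = q powr ((real M)\<^sup>2 / 2) * (right_tree m (q ^ u) (q ^ v) (q ^ w) / q ^ (m * (M - m)))"
    using p[OF m] by simp
  also have "\<dots> = (\<Sum>s\<le>M. q_racah q s m b a (b * c * q ^ (M + 1)) M
      * (q powr ((real M)\<^sup>2 / 2) / q ^ (s * (M - s)) * left_tree s (q ^ u) (q ^ v) (q ^ w)))"
    unfolding right_tree_expansion[OF m] sum_distrib_left by (intro sum.cong) simp_all
  also have "\<dots> = (\<Sum>s\<le>M. q_racah q s m b a (b * c * q ^ (M + 1)) M * (hahn_node q s a b (q ^ u) (q ^ v)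
        * hahn_node q (M - s) (a * b * q ^ (2 * s + 1)) c (q ^ u * q ^ v / q ^ s) (q ^ w)))"
    by (intro sum.cong refl) (simp add: p[symmetric] hahn_node_def left_tree_def mult_ac)
  finally show ?thesis .
qed

section \<open>Index sums and nonvanishing denominators\<close>

lemma iidx_Suc: "2 \<le> k \<Longrightarrow> iidx \<nu> (Suc k) = iidx \<nu> k + \<nu> k"
  by (simp add: iidx_def)

lemma iidx_2 [simp]: "iidx \<nu> 2 = 0"
  by (simp add: iidx_def)

lemma iidx_cong: "(\<And>l. 2 \<le> l \<Longrightarrow> l < k \<Longrightarrow> \<nu> l = \<mu> l) \<Longrightarrow> iidx \<nu> k = iidx \<mu> k"
  by (auto simp: iidx_def intro!: sum.cong)

lemma psum_Suc: "psum x (Suc k) = psum x k + x (Suc k)"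
  by (simp add: psum_def)

lemma psum_0 [simp]: "psum x 0 = 0"
  by (simp add: psum_def)

lemma pprod_Suc: "pprod \<alpha> (Suc k) = pprod \<alpha> k * \<alpha> (Suc k)"
  by (simp add: pprod_def)

lemma psum_mono: "k \<le> l \<Longrightarrow> psum x k \<le> psum x l"
  unfolding psum_def by (rule sum_mono2) auto

locale hahn_combs =
  fixes q :: real and h N n :: nat and \<alpha> :: "nat \<Rightarrow> real" and m :: "nat \<Rightarrow> nat"
  assumes q: "0 < q" "q < 1"
    and h: "h \<ge> 3" and N: "N \<ge> 1" and n: "n \<le> N"
    and \<alpha>: "(\<forall>i\<in>{1..h}. 0 < \<alpha> i \<and> \<alpha> i < 1 / q) \<or> (\<forall>i\<in>{1..h}. \<alpha> i > 1 / q ^ N)"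
    and m: "(\<Sum>k=1..h-1. m k) = n"
begin

abbreviation "A \<equiv> pprod \<alpha>"
abbreviation "J \<equiv> jidx h m"

lemma q0 [simp]: "q \<noteq> 0" using q by simp

lemma \<alpha>_pos: "1 \<le> k \<Longrightarrow> k \<le> h \<Longrightarrow> 0 < \<alpha> k"
proof -
  assume k: "1 \<le> k" "k \<le> h"
  have "0 < 1 / q ^ N" using q by simp
  with \<alpha> k show "0 < \<alpha> k" by (meson atLeastAtMost_iff less_trans)
qed

lemma A_pos: "k \<le> h \<Longrightarrow> 0 < A k"
  unfolding pprod_def by (intro prod_pos) (auto intro: \<alpha>_pos)

text \<open>If every \<alpha> i q < 1, then A_k q^k < 1 and larger exponents decrease it further; if
  every \<alpha> i q^N > 1, then A_k q^(kN) > 1 and smaller exponents increase it.\<close>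

lemma A_power_neq_1:
  assumes k: "1 \<le> k" "k \<le> h" and e: "k \<le> e" "e \<le> k * N"
  shows "A k * q ^ e \<noteq> 1"
  using \<alpha>
proof
  assume 1: "\<forall>i\<in>{1..h}. 0 < \<alpha> i \<and> \<alpha> i < 1 / q"
  have "A k * q ^ k < 1 \<and> 0 < A k * q ^ k" using k
  proof (induction k rule: nat_induct_at_least)
    case base
    then show ?case using 1 q by (auto simp: pprod_def field_simps)
  next
    case (Suc k)
    have "0 < \<alpha> (Suc k) * q" "\<alpha> (Suc k) * q < 1" using 1 q Suc.prems by (auto simp: field_simps)
    moreover have E: "A (Suc k) * q ^ Suc k = (A k * q ^ k) * (\<alpha> (Suc k) * q)" by (simp add: pprod_Suc mult_ac)
    moreover have "A k * q ^ k < 1" "0 < A k * q ^ k" using Suc by auto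
    ultimately show ?case
      unfolding E using mult_strict_mono[of "A k * q ^ k" 1 "\<alpha> (Suc k) * q" 1] by simp
  qed
  moreover have "q ^ e \<le> q ^ k" using e q by (intro power_decreasing) auto
  ultimately show ?thesis using A_pos[OF k(2)] by (smt (verit) mult_left_mono)
next
  assume 2: "\<forall>i\<in>{1..h}. \<alpha> i > 1 / q ^ N"
  have "A k * q ^ (k * N) > 1" using k
  proof (induction k rule: nat_induct_at_least)
    case base
    then have "\<alpha> 1 > 1 / q ^ N" using 2 by simp
    then show ?case using q by (simp add: pprod_def field_simps)
  next
    case (Suc k)
    have "1 / q ^ N < \<alpha> (Suc k)" using 2 Suc.prems by simp
    then have "1 < \<alpha> (Suc k) * q ^ N" using q by (simp add: field_simps)
    moreover have "A (Suc k) * q ^ (Suc k * N) = (A k * q ^ (k * N)) * (\<alpha> (Suc k) * q ^ N)"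
      by (simp add: pprod_Suc power_add mult_ac)
    moreover have "1 < A k * q ^ (k * N)" using Suc by auto
    ultimately show ?case by (simp add: less_1_mult)
  qed
  moreover have "q ^ (k * N) \<le> q ^ e" using e q by (intro power_decreasing) auto
  ultimately show ?thesis using A_pos[OF k(2)] by (smt (verit) mult_left_mono)
qed

lemma \<alpha>_power_neq_1:
  assumes k: "1 \<le> k" "k \<le> h" and e: "1 \<le> e" "e \<le> N"
  shows "\<alpha> k * q ^ e \<noteq> 1"
  using \<alpha>
proof
  assume "\<forall>i\<in>{1..h}. 0 < \<alpha> i \<and> \<alpha> i < 1 / q"
  then have "\<alpha> k * q < 1" using k q by (auto simp: field_simps)
  moreover have "q ^ e \<le> q ^ 1" using e q by (intro power_decreasing) auto
  ultimately show ?thesis using \<alpha>_pos[OF k] by (smt (verit) mult_left_mono power_one_right)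
next
  assume "\<forall>i\<in>{1..h}. \<alpha> i > 1 / q ^ N"
  then have "\<alpha> k * q ^ N > 1" using k q by (auto simp: field_simps)
  moreover have "q ^ N \<le> q ^ e" using e q by (intro power_decreasing) auto
  ultimately show ?thesis using \<alpha>_pos[OF k] by (smt (verit) mult_left_mono)
qed

lemma A_step: "2 \<le> k \<Longrightarrow> A k = A (k - 1) * \<alpha> k"
  using pprod_Suc[of \<alpha> "k - 1"] by simp

text \<open>Every denominator is 1 minus some \<alpha> or A times a power of q, so it remains to fit
  the exponents into the allowed ranges. For k = 2 the product A_1 allows exponents only up to N,
  and 2 i + e \<le> N is guaranteed because i = 0; for k \<ge> 3 the bound (k-1) N leaves
  room.\<close>

lemma three_leaves_node:
  assumes k: "2 \<le> k" "k \<le> h - 1" and ij: "i + j \<le> n" and i0: "k = 2 \<Longrightarrow> i = 0"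
  shows "three_leaves q (A (k - 1) * q powi (int k + 2 * int i - 2)) (\<alpha> k)
    (A h / A k * q powi (int h - int k + 2 * int j - 1)) (n - i - j)"
proof -
  define M where "M = n - i - j"
  have M: "i + j + M \<le> N" using ij n M_def by simp
  have p1: "q powi (int k + 2 * int i - 2) = q ^ (k - 2 + 2 * i)"
    by (rule powi_eq_power) (use k in simp)
  have p2: "q powi (int h - int k + 2 * int j - 1) = q ^ (h - k - 1 + 2 * j)"
    by (rule powi_eq_power) (use k h in simp)
  have "k \<le> h" using k by linarith
  from A_pos[OF this] have Ak: "A k \<noteq> 0" by simp
  show ?thesis
    unfolding p1 p2 M_def[symmetric]
  proof
    fix e assume e: "1 \<le> e" "e \<le> M"
    have "k - 2 + 2 * i + e \<le> (k - 1) * N"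
    proof (cases "k = 2")
      case True
      then show ?thesis using i0 e M by simp
    next
      case False
      then obtain l where l: "k = l + 3" using k by (metis add.commute le_antisym le_iff_add not_less_eq_eq numeral_2_eq_2 numeral_3_eq_3)
      have "l \<le> l * N" "(l + 3 - 1) * N = l * N + 2 * N" using N by simp_all
      then show ?thesis using e M unfolding l by linarith
    qed
    then have "A (k - 1) * q ^ (k - 2 + 2 * i + e) \<noteq> 1"
      using k e by (intro A_power_neq_1) auto
    then show "A (k - 1) * q ^ (k - 2 + 2 * i) * q ^ e \<noteq> 1" by (simp add: power_add mult_ac)
  next
    fix e assume "1 \<le> e" "e \<le> M"
    then show "\<alpha> k * q ^ e \<noteq> 1" using k M by (intro \<alpha>_power_neq_1) auto
  next
    fix e assume e: "2 \<le> e" "e \<le> 2 * M"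
    obtain l where l: "k = l + 2" using k by (metis add.commute le_iff_add)
    have "l \<le> l * N" "(l + 2) * N = l * N + 2 * N" using N by simp_all
    then have "k - 2 + 2 * i + e \<le> k * N" using e M unfolding l by linarith
    then have "A k * q ^ (k - 2 + 2 * i + e) \<noteq> 1"
      using k e by (intro A_power_neq_1) auto
    then show "A (k - 1) * q ^ (k - 2 + 2 * i) * \<alpha> k * q ^ e \<noteq> 1"
      using A_step[OF k(1)] by (simp add: power_add mult_ac)
  next
    fix e assume e: "M + 2 \<le> e" "e \<le> 2 * M + 1"
    obtain l where l: "h = l + 3" using h by (metis add.commute le_iff_add)
    have "l \<le> l * N" "(l + 3) * N = l * N + 3 * N" "l + 3 - 3 = l"
      using N by (simp_all only: add_mult_distrib) simp_all
    then have "h - 3 + 2 * i + 2 * j + e \<le> h * N" using e M N unfolding l by linarith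
    then have "A h * q ^ (h - 3 + 2 * i + 2 * j + e) \<noteq> 1"
      using h e by (intro A_power_neq_1) auto
    moreover have "h - 3 + 2 * i + 2 * j + e = (k - 2 + 2 * i) + (h - k - 1 + 2 * j) + e"
      using h k by simp
    then have "q ^ (h - 3 + 2 * i + 2 * j + e) = q ^ (k - 2 + 2 * i) * q ^ (h - k - 1 + 2 * j) * q ^ e"
      by (metis power_add)
    ultimately show "A (k - 1) * q ^ (k - 2 + 2 * i) * \<alpha> k * (A h / A k * q ^ (h - k - 1 + 2 * j)) * q ^ e \<noteq> 1"
      using Ak A_step[OF k(1)] by (simp add: field_simps)
  qed (use q in auto)
qed

section \<open>Nodes of the two combs and of the intermediate trees\<close>

lemma J_step: "1 \<le> k \<Longrightarrow> k \<le> h - 1 \<Longrightarrow> J (k - 1) = m k + J k"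
  unfolding jidx_def by (cases k) (simp_all add: sum.atLeast_Suc_atMost)

lemma J_last [simp]: "J (h - Suc 0) = 0"
  using h by (simp add: jidx_def)

lemma J_0: "J 0 = n"
  using m by (simp add: jidx_def)

text \<open>Integer exponents allow X_(k-1) < i_k; the product of nodes then vanishes without a case
  distinction.\<close>

definition left_node :: "(nat \<Rightarrow> nat) \<Rightarrow> (nat \<Rightarrow> nat) \<Rightarrow> nat \<Rightarrow> real" where
  "left_node x \<nu> k = hahn_node q (\<nu> k) (A (k - 1) * q powi (int k + 2 * int (iidx \<nu> k) - 2)) (\<alpha> k)
     (q powi (int (psum x (k - 1)) - int (iidx \<nu> k))) (q ^ x k)"

definition right_node :: "(nat \<Rightarrow> nat) \<Rightarrow> nat \<Rightarrow> real" where
  "right_node x k = q powi (- int (J k * x k))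
     * hahn_node q (m k) (\<alpha> k) (A h / A k * q powi (int h - int k + 2 * int (J k) - 1))
         (q ^ x k) (q powi (int (psum x h) - int (psum x k) - int (J k)))"

text \<open>The root of the intermediate tree that joins a left comb on the leaves 1, ..., k-1 to a
  right comb on k, ..., h. For k = 2 it is the root of the right comb, for k = h that of the left
  comb.\<close>

definition root_node :: "(nat \<Rightarrow> nat) \<Rightarrow> (nat \<Rightarrow> nat) \<Rightarrow> nat \<Rightarrow> real" where
  "root_node x \<nu> k = q powi (- int (J (k - 1) * psum x (k - 1)))
     * hahn_node q (n - iidx \<nu> k - J (k - 1)) (A (k - 1) * q powi (int k + 2 * int (iidx \<nu> k) - 2))
         (A h / A (k - 1) * q powi (int h - int k + 2 * int (J (k - 1))))
         (q powi (int (psum x (k - 1)) - int (iidx \<nu> k)))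
         (q powi (int (psum x h) - int (psum x (k - 1)) - int (J (k - 1))))"

definition racah_factor :: "(nat \<Rightarrow> nat) \<Rightarrow> nat \<Rightarrow> real" where
  "racah_factor \<nu> k = q powi (- int (m k * iidx \<nu> k)) *
        q_racah q (\<nu> k) (m k) (\<alpha> k)
          (A (k - 1) * q powi (2 * int (iidx \<nu> k) + int k - 2))
          (A h / A (k - 1) * q powi (int n + int (J k) - int (iidx \<nu> k) + int h - int k))
          (n - iidx \<nu> k - J k)"

lemma hahn_node_eq_0: "u + v < d \<Longrightarrow> hahn_node q d a b (q ^ u) (q ^ v) = 0"
  by (simp add: hahn_node_def hahn_eq_0)

text \<open>At the first index where X_(k-1) \<ge> i_k fails, the preceding node has coordinates
  whose sum is below its degree, so \<open>hahn_eq_0\<close> applies.\<close>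

lemma prod_left_node_eq_0:
  assumes "2 \<le> k" "psum x (k - 1) < iidx \<nu> k"
  shows "(\<Prod>l\<in>{2..<k}. left_node x \<nu> l) = 0"
  using assms
proof (induction k rule: nat_induct_at_least)
  case base
  then show ?case by simp
next
  case (Suc k)
  show ?case
  proof (cases "psum x (k - 1) < iidx \<nu> k")
    case True
    then show ?thesis using Suc by simp
  next
    case False
    have "psum x k = psum x (k - 1) + x k" using psum_Suc[of x "k - 1"] Suc.hyps by simp
    then have "psum x (k - 1) - iidx \<nu> k + x k < \<nu> k"
      using Suc.prems False iidx_Suc[OF Suc.hyps] by simp
    moreover have "q powi (int (psum x (k - 1)) - int (iidx \<nu> k)) = q ^ (psum x (k - 1) - iidx \<nu> k)"
      by (rule powi_eq_power) (use False in simp)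
    ultimately have "left_node x \<nu> k = 0"
      unfolding left_node_def by (simp add: hahn_node_eq_0)
    then show ?thesis using Suc.hyps by simp
  qed
qed

lemma prod_right_node_eq_0:
  assumes "k \<le> h - 1" "psum x h < psum x k + J k"
  shows "(\<Prod>l=k + 1..h - 1. right_node x l) = 0"
  using assms
proof (induction k rule: inc_induct)
  case base
  then show ?case using psum_mono[of "h - 1" h x] by simp
next
  case (step k)
  have split: "(\<Prod>l=k + 1..h - 1. right_node x l) = right_node x (Suc k) * (\<Prod>l=Suc k + 1..h - 1. right_node x l)"
    using step.hyps by (simp add: prod.atLeast_Suc_atMost)
  show ?case
  proof (cases "psum x h < psum x (Suc k) + J (Suc k)")
    case True
    then show ?thesis using step split by simp
  next
    case False
    define w where "w = psum x h - psum x (Suc k) - J (Suc k)"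
    have "x (Suc k) + w < m (Suc k)"
      using False step.prems J_step[of "Suc k"] step.hyps psum_Suc[of x k] by (simp add: w_def)
    moreover have "q powi (int (psum x h) - int (psum x (Suc k)) - int (J (Suc k))) = q ^ w"
      by (rule powi_eq_power) (use False in \<open>simp add: w_def\<close>)
    ultimately have "right_node x (Suc k) = 0"
      unfolding right_node_def by (simp add: hahn_node_eq_0)
    then show ?thesis using split by simp
  qed
qed

lemma xi_eq_prod:
  assumes x: "psum x h = N"
  shows "xi q h \<alpha> m x = (\<Prod>k=1..h - 1. right_node x k)"
proof -
  have s: "(\<Sum>i=k..h. x i) = psum x h - psum x (k - 1)" "psum x (k - 1) \<le> psum x h" if "1 \<le> k" "k \<le> h - 1" for k
  proof -
    have "{1..h} = {1..k - 1} \<union> {k..h}" using that by auto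
    then have "psum x h = psum x (k - 1) + (\<Sum>i=k..h. x i)"
      unfolding psum_def by (simp only:) (subst sum.union_disjoint, use that in auto)
    then show "(\<Sum>i=k..h. x i) = psum x h - psum x (k - 1)" "psum x (k - 1) \<le> psum x h" by auto
  qed
  show ?thesis
  proof (cases "\<forall>k\<in>{1..h-1}. (\<Sum>i=k..h. x i) \<ge> J (k - 1)")
    case True
    have T: "psum x (k - 1) + J (k - 1) \<le> psum x h" if "1 \<le> k" "k \<le> h - 1" for k
    proof -
      have "J (k - 1) \<le> (\<Sum>i=k..h. x i)" using True that by auto
      then show ?thesis using s[OF that] by linarith
    qed
    have "q powi (- int (J k * x k)) *
           q_hahn q (m k) (x k) (\<alpha> k) (A h / A k * q powi (int h - int k + 2 * int (J k) - 1))
             (psum x h - psum x (k - 1) - J k) = right_node x k" if k: "1 \<le> k" "k \<le> h - 1" for k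
    proof -
      have ps: "psum x k = psum x (k - 1) + x k" using psum_Suc[of x "k - 1"] k by simp
      \<comment> \<open>The bound needed at node k is the condition of \<open>xi\<close> at k + 1;
        at the last node it reduces to X_(h-1) \<le> X_h because J is 0 there.\<close>
      have T2: "psum x k + J k \<le> psum x h"
      proof (cases "k = h - 1")
        case True
        then show ?thesis using psum_mono[of k h x] by simp
      next
        case False
        then show ?thesis using T[of "Suc k"] k by simp
      qed
      have "q powi (int (psum x h) - int (psum x k) - int (J k)) = q ^ (psum x h - psum x (k - 1) - J k - x k)"
        by (rule powi_eq_power) (use T2 ps in simp)
      moreover have "x k \<le> psum x h - psum x (k - 1) - J k" "m k \<le> psum x h - psum x (k - 1) - J k"
        using T2 T[OF k] J_step[OF k] ps by simp_all
      ultimately show ?thesis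
        unfolding right_node_def hahn_node_def by (simp add: q_hahn_eq_hahn[OF q])
    qed
    then show ?thesis using True unfolding xi_def by (auto intro!: prod.cong)
  next
    case False
    then obtain k where k: "1 \<le> k" "k \<le> h - 1" "(\<Sum>i=k..h. x i) < J (k - 1)" by force
    have "k \<noteq> 1" using k(3) s(1)[OF k(1,2)] J_0 x n by auto
    have "(\<Prod>l=(k - 1) + 1..h - 1. right_node x l) = 0"
      using k s[OF k(1,2)] by (intro prod_right_node_eq_0) auto
    then have "(\<Prod>l=1..h - 1. right_node x l) = 0"
      using k by (auto simp: prod_zero_iff)
    then show ?thesis using False unfolding xi_def by auto
  qed
qed

lemma theta_eq_prod:
  assumes x: "psum x h = N" and \<nu>: "iidx \<nu> (h + 1) = n"
  shows "theta q h \<alpha> \<nu> x = (\<Prod>k=2..h. left_node x \<nu> k)"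
proof (cases "\<forall>k\<in>{3..h+1}. psum x (k - 1) \<ge> iidx \<nu> k")
  case True
  have "q_hahn q (\<nu> k) (psum x (k - 1) - iidx \<nu> k)
           (A (k - 1) * q powi (int k + 2 * int (iidx \<nu> k) - 2)) (\<alpha> k)
           (psum x k - iidx \<nu> k) = left_node x \<nu> k" if k: "2 \<le> k" "k \<le> h" for k
  proof -
    have ps: "psum x k = psum x (k - 1) + x k" using psum_Suc[of x "k - 1"] k by simp
    have T: "iidx \<nu> k \<le> psum x (k - 1)"
      using True k by (cases "k = 2") auto
    have "iidx \<nu> (Suc k) \<le> psum x k" using True[rule_format, of "Suc k"] k by simp
    then have T2: "\<nu> k \<le> psum x k - iidx \<nu> k" using iidx_Suc[OF k(1)] by simp
    have le: "psum x (k - 1) - iidx \<nu> k \<le> psum x k - iidx \<nu> k" using ps by simp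
    have e: "psum x k - iidx \<nu> k - (psum x (k - 1) - iidx \<nu> k) = x k" using ps T by simp
    have "q powi (int (psum x (k - 1)) - int (iidx \<nu> k)) = q ^ (psum x (k - 1) - iidx \<nu> k)"
      by (rule powi_eq_power) (use T in simp)
    then show ?thesis
      unfolding left_node_def hahn_node_def q_hahn_eq_hahn[OF q le T2] e by simp
  qed
  then show ?thesis using True unfolding theta_def by (auto intro!: prod.cong)
next
  case False
  then obtain k where k: "3 \<le> k" "k \<le> h + 1" "psum x (k - 1) < iidx \<nu> k" by force
  have "(\<Prod>l\<in>{2..<k}. left_node x \<nu> l) = 0"
    using k by (intro prod_left_node_eq_0) auto
  then have "(\<Prod>l=2..h. left_node x \<nu> l) = 0"
    using k by (auto simp: prod_zero_iff)
  then show ?thesis using False unfolding theta_def by auto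
qed

text \<open>The three-leaf identity for the left comb on 1, ..., k-1 (coordinate X_(k-1) - i), the
  leaf k, and the right comb on k+1, ..., h (coordinate X_h - X_k - j), with M = n - i - j.\<close>

lemma rotation:
  assumes k: "2 \<le> k" "k \<le> h - 1" and ij: "iidx \<nu> k + J (k - 1) \<le> n"
    and u: "iidx \<nu> k \<le> psum x (k - 1)" and w: "psum x k + J k \<le> psum x h"
  shows "root_node x \<nu> k * right_node x k
    = (\<Sum>s\<le>n - iidx \<nu> k - J k. racah_factor (\<nu>(k := s)) k * left_node x (\<nu>(k := s)) k * root_node x (\<nu>(k := s)) (Suc k))"
proof -
  define i j M where "i = iidx \<nu> k" and "j = J k" and "M = n - i - j"
  have Jk: "J (k - 1) = m k + j" using J_step[of k] k j_def by simp
  have mM: "m k \<le> M" "i + j \<le> n" using ij Jk by (simp_all add: M_def i_def)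
  define u' w' v where "u' = psum x (k - 1) - i" and "w' = psum x h - psum x k - j" and "v = x k"
  have ps: "psum x k = psum x (k - 1) + v" using psum_Suc[of x "k - 1"] k by (simp add: v_def)
  define a b c where "a = A (k - 1) * q powi (int k + 2 * int i - 2)" and "b = \<alpha> k"
    and "c = A h / A k * q powi (int h - int k + 2 * int j - 1)"
  interpret L: three_leaves q a b c M
    unfolding a_def b_def c_def M_def
    using mM k by (intro three_leaves_node) (auto simp: i_def)
  have Ak: "A k = A (k - 1) * b" "b \<noteq> 0" "A (k - 1) \<noteq> 0"
  proof -
    have kh: "k \<le> h" "k - 1 \<le> h" "1 \<le> k" using k by linarith+
    show "A k = A (k - 1) * b" "b \<noteq> 0" "A (k - 1) \<noteq> 0"
      using A_step[OF k(1)] A_pos[OF kh(2)] \<alpha>_pos[OF kh(3,1)] by (auto simp: b_def)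
  qed
  have iu: "iidx (\<nu>(k := s)) k = i" "iidx (\<nu>(k := s)) (Suc k) = i + s" for s
  proof -
    show "iidx (\<nu>(k := s)) k = i" unfolding i_def by (rule iidx_cong) auto
    then show "iidx (\<nu>(k := s)) (Suc k) = i + s" using iidx_Suc[OF k(1)] by simp
  qed
  have U: "q powi (int (psum x (k - 1)) - int i) = q ^ u'"
    by (rule powi_eq_power) (use u in \<open>simp add: u'_def i_def\<close>)
  have W: "q powi (int (psum x h) - int (psum x k) - int j) = q ^ w'"
    by (rule powi_eq_power) (use w in \<open>simp add: w'_def j_def\<close>)
  have VW: "q powi (int (psum x h) - int (psum x (k - 1)) - int (m k + j)) = q ^ v * q ^ w' / q ^ m k"
  proof -
    have "int (psum x h) - int (psum x (k - 1)) - int (m k + j) = int v + int w' - int (m k)"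
      using w ps by (simp add: w'_def j_def)
    then show ?thesis by (simp only: power_int_diff power_int_add power_int_of_nat q0 not_False_eq_True simp_thms)
  qed
  have UV: "q powi (int (psum x k) - int (i + s)) = q ^ u' * q ^ v / q ^ s" for s
  proof -
    have "int (psum x k) - int (i + s) = int u' + int v - int s"
      using u ps by (simp add: u'_def i_def)
    then show ?thesis by (simp only: power_int_diff power_int_add power_int_of_nat q0 not_False_eq_True simp_thms)
  qed
  have bc: "A h / A (k - 1) * q powi (int h - int k + 2 * int (m k + j)) = b * c * q ^ (2 * m k + 1)"
  proof -
    have "int h - int k + 2 * int (m k + j) = (int h - int k + 2 * int j - 1) + int (2 * m k + 1)" by simp
    then have "q powi (int h - int k + 2 * int (m k + j)) = q powi (int h - int k + 2 * int j - 1) * q ^ (2 * m k + 1)"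
      by (simp only: power_int_add power_int_of_nat q0 not_False_eq_True simp_thms)
    then show ?thesis using Ak by (simp add: c_def)
  qed
  have bcM: "A h / A (k - 1) * q powi (int n + int j - int i + int h - int k) = b * c * q ^ (M + 1)"
  proof -
    have "int n + int j - int i + int h - int k = (int h - int k + 2 * int j - 1) + int (M + 1)"
      using mM by (simp add: M_def)
    then have "q powi (int n + int j - int i + int h - int k) = q powi (int h - int k + 2 * int j - 1) * q ^ (M + 1)"
      by (simp only: power_int_add power_int_of_nat q0 not_False_eq_True simp_thms)
    then show ?thesis using Ak by (simp add: c_def)
  qed
  have abS: "A k * q powi (int (Suc k) + 2 * int (i + s) - 2) = a * b * q ^ (2 * s + 1)" for s
  proof -
    have "int (Suc k) + 2 * int (i + s) - 2 = (int k + 2 * int i - 2) + int (2 * s + 1)" by simp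
    then have "q powi (int (Suc k) + 2 * int (i + s) - 2) = q powi (int k + 2 * int i - 2) * q ^ (2 * s + 1)"
      by (simp only: power_int_add power_int_of_nat q0 not_False_eq_True simp_thms)
    then show ?thesis using Ak by (simp add: a_def)
  qed
  \<comment> \<open>From X_(k-1) = u' + i follows (m_k + j) X_(k-1) + j x_k = m_k u' + m_k i + j
    X_k. The first term is the U^-m of the right tree, the last belongs to the next root, and the
    middle one is the origin of q^(-m_k i_k) in the coefficients.\<close>
  define e where "e = q powi (- int (m k * i)) * q powi (- int (j * psum x k))"
  have e: "q powi (- int ((m k + j) * psum x (k - 1))) * q powi (- int (j * v)) = e / (q ^ u') ^ m k"
  proof -
    have "- int ((m k + j) * psum x (k - 1)) + - int (j * v)
        = - int (m k * i) + - int (j * psum x k) - int (u' * m k)"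
      using u ps by (simp add: u'_def i_def of_nat_diff algebra_simps)
    then have "q powi (- int ((m k + j) * psum x (k - 1)) + - int (j * v))
        = q powi (- int (m k * i) + - int (j * psum x k) - int (u' * m k))" by simp
    then show ?thesis unfolding e_def
      by (simp only: power_int_diff power_int_add power_int_of_nat q0 not_False_eq_True simp_thms power_mult)
  qed
  have "root_node x \<nu> k * right_node x k
      = q powi (- int ((m k + j) * psum x (k - 1))) * q powi (- int (j * v))
        * (hahn_node q (M - m k) a (b * c * q ^ (2 * m k + 1)) (q ^ u') (q ^ v * q ^ w' / q ^ m k)
           * hahn_node q (m k) b c (q ^ v) (q ^ w'))"
  proof -
    have "n - i - (m k + j) = M - m k" by (simp add: M_def)
    then show ?thesis
      unfolding root_node_def right_node_def i_def[symmetric] j_def[symmetric] Jk bc VW U W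
        a_def[symmetric] b_def[symmetric] c_def[symmetric] v_def[symmetric] by (simp only: mult_ac)
  qed
  also have "\<dots> = e * (hahn_node q (M - m k) a (b * c * q ^ (2 * m k + 1)) (q ^ u') (q ^ v * q ^ w' / q ^ m k)
           * hahn_node q (m k) b c (q ^ v) (q ^ w') / (q ^ u') ^ m k)"
    unfolding e by simp
  also have "\<dots> = (\<Sum>s\<le>M. e * (q_racah q s (m k) b a (b * c * q ^ (M + 1)) M * (hahn_node q s a b (q ^ u') (q ^ v)
        * hahn_node q (M - s) (a * b * q ^ (2 * s + 1)) c (q ^ u' * q ^ v / q ^ s) (q ^ w'))))"
    unfolding L.node_rotation[OF mM(1)] sum_distrib_left ..
  also have "\<dots> = (\<Sum>s\<le>M. racah_factor (\<nu>(k := s)) k * left_node x (\<nu>(k := s)) k * root_node x (\<nu>(k := s)) (Suc k))"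
  proof (intro sum.cong refl)
    fix s
    have 1: "n - (i + s) - j = M - s" by (simp add: M_def)
    have 2: "racah_factor (\<nu>(k := s)) k = q powi (- int (m k * i)) * q_racah q s (m k) b a (b * c * q ^ (M + 1)) M"
      unfolding racah_factor_def iu j_def[symmetric] bcM M_def[symmetric] b_def[symmetric] fun_upd_same
      by (simp add: a_def add.commute)
    have 3: "left_node x (\<nu>(k := s)) k = hahn_node q s a b (q ^ u') (q ^ v)"
      unfolding left_node_def iu U a_def[symmetric] b_def[symmetric] fun_upd_same v_def ..
    have 4: "root_node x (\<nu>(k := s)) (Suc k) = q powi (- int (j * psum x k))
       * hahn_node q (M - s) (a * b * q ^ (2 * s + 1)) c (q ^ u' * q ^ v / q ^ s) (q ^ w')"
    proof -
      have "A h / A k * q powi (int h - int (Suc k) + 2 * int j) = c" by (simp add: c_def algebra_simps)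
      then show ?thesis
        unfolding root_node_def iu diff_Suc_1 j_def[symmetric] UV W abS 1 by simp
    qed
    show "e * (q_racah q s (m k) b a (b * c * q ^ (M + 1)) M * (hahn_node q s a b (q ^ u') (q ^ v)
        * hahn_node q (M - s) (a * b * q ^ (2 * s + 1)) c (q ^ u' * q ^ v / q ^ s) (q ^ w')))
      = racah_factor (\<nu>(k := s)) k * left_node x (\<nu>(k := s)) k * root_node x (\<nu>(k := s)) (Suc k)"
      unfolding 2 3 4 e_def by (simp only: mult_ac)
  qed
  finally show ?thesis by (simp add: M_def i_def j_def)
qed

section \<open>Induction over the rotations\<close>

definition partial_admissible :: "nat \<Rightarrow> (nat \<Rightarrow> nat) set" where
  "partial_admissible k = {\<nu> \<in> {2..<k} \<rightarrow>\<^sub>E UNIV. \<forall>l\<in>{2..<k}. \<nu> l + iidx \<nu> l + J l \<le> n}"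

lemma partial_admissible_iidx:
  assumes "\<nu> \<in> partial_admissible k" "2 \<le> k" "k \<le> h"
  shows "iidx \<nu> k + J (k - 1) \<le> n"
proof (cases "k = 2")
  case True
  then show ?thesis using J_step[of 1] J_0 h by simp
next
  case False
  then have "\<nu> (k - 1) + iidx \<nu> (k - 1) + J (k - 1) \<le> n"
    using assms by (auto simp: partial_admissible_def)
  moreover have "iidx \<nu> k = iidx \<nu> (k - 1) + \<nu> (k - 1)"
    using iidx_Suc[of "k - 1" \<nu>] assms False by simp
  ultimately show ?thesis by simp
qed

lemma finite_partial_admissible: "finite (partial_admissible k)"
proof (rule finite_subset)
  show "partial_admissible k \<subseteq> {2..<k} \<rightarrow>\<^sub>E {..n}"
    by (force simp: partial_admissible_def PiE_def Pi_def)
qed (simp add: finite_PiE)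

lemma iidx_upd: "l \<le> k \<Longrightarrow> iidx (\<nu>(k := s)) l = iidx \<nu> l"
  by (rule iidx_cong) auto

lemma sum_partial_admissible_Suc:
  fixes f :: "(nat \<Rightarrow> nat) \<Rightarrow> real"
  assumes k: "2 \<le> k" "k \<le> h - 1"
  shows "(\<Sum>\<nu>\<in>partial_admissible (Suc k). f \<nu>)
    = (\<Sum>\<nu>\<in>partial_admissible k. \<Sum>s\<le>n - iidx \<nu> k - J k. f (\<nu>(k := s)))"
proof -
  have ij: "iidx \<nu> k + J k \<le> n" if "\<nu> \<in> partial_admissible k" for \<nu>
  proof -
    have "k \<le> h" using k by linarith
    from partial_admissible_iidx[OF that k(1) this] J_step[of k] k show ?thesis by simp
  qed
  have "(\<Sum>\<nu>\<in>partial_admissible (Suc k). f \<nu>)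
      = (\<Sum>(\<nu>, s)\<in>(SIGMA \<nu>:partial_admissible k. {..n - iidx \<nu> k - J k}). f (\<nu>(k := s)))"
  proof (rule sum.reindex_bij_witness[where i = "\<lambda>(\<nu>, s). \<nu>(k := s)" and j = "\<lambda>\<nu>. (\<nu>(k := undefined), \<nu> k)"])
    fix \<nu> assume \<nu>: "\<nu> \<in> partial_admissible (Suc k)"
    have "\<nu> l + iidx (\<nu>(k := undefined)) l + J l \<le> n" if "2 \<le> l" "l < k" for l
      using \<nu> that by (auto simp: partial_admissible_def iidx_upd)
    moreover have "\<nu> k + iidx (\<nu>(k := undefined)) k + J k \<le> n"
      using \<nu> k by (auto simp: partial_admissible_def iidx_upd)
    ultimately show "(\<nu>(k := undefined), \<nu> k) \<in> (SIGMA \<nu>:partial_admissible k. {..n - iidx \<nu> k - J k})"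
      using \<nu> by (auto simp: partial_admissible_def PiE_iff extensional_def)
  next
    fix b assume b: "b \<in> (SIGMA \<nu>:partial_admissible k. {..n - iidx \<nu> k - J k})"
    then obtain \<nu> s where [simp]: "b = (\<nu>, s)" and \<nu>: "\<nu> \<in> partial_admissible k" "s \<le> n - iidx \<nu> k - J k"
      by auto
    have "\<nu> k = undefined" using \<nu> by (auto simp: partial_admissible_def PiE_iff extensional_def)
    then show "((case b of (\<nu>, s) \<Rightarrow> \<nu>(k := s))(k := undefined), (case b of (\<nu>, s) \<Rightarrow> \<nu>(k := s)) k) = b"
      by (simp add: fun_upd_idem)
    show "(case b of (\<nu>, s) \<Rightarrow> \<nu>(k := s)) \<in> partial_admissible (Suc k)"
      using \<nu> ij[OF \<nu>(1)] k
      by (auto simp: partial_admissible_def PiE_iff extensional_def iidx_upd less_Suc_eq)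
  qed auto
  then show ?thesis
    using finite_partial_admissible by (simp add: sum.Sigma)
qed

lemma factor_upd:
  assumes "l < k"
  shows "racah_factor (\<nu>(k := s)) l = racah_factor \<nu> l" "left_node x (\<nu>(k := s)) l = left_node x \<nu> l"
  using assms by (simp_all add: racah_factor_def left_node_def iidx_upd)

text \<open>The invariant after k - 2 rotations: left nodes and q-Racah factors below k, one root,
  and the untouched right nodes from k on.\<close>

lemma right_comb_expansion:
  assumes "2 \<le> k" "k \<le> h"
  shows "(\<Prod>l=1..h - 1. right_node x l) = (\<Sum>\<nu>\<in>partial_admissible k.
    (\<Prod>l\<in>{2..<k}. racah_factor \<nu> l * left_node x \<nu> l) * root_node x \<nu> k * (\<Prod>l=k..h - 1. right_node x l))"
  using assms
proof (induction k rule: nat_induct_at_least)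
  case base
  \<comment> \<open>No rotation has taken place, so the only index is the empty tuple.\<close>
  have PA: "partial_admissible 2 = {\<lambda>_. undefined}"
    by (simp add: partial_admissible_def)
  have J1: "m 1 + J 1 = n" using J_step[of 1] J_0 h by simp
  have "root_node x (\<lambda>_. undefined) 2 = right_node x 1"
    using J1 unfolding root_node_def right_node_def
    by (auto simp: psum_def pprod_def algebra_simps)
  moreover have "(\<Prod>l=1..h - 1. right_node x l) = right_node x 1 * (\<Prod>l=2..h - 1. right_node x l)"
    using h by (subst prod.atLeast_Suc_atMost) (auto simp: numeral_2_eq_2)
  ultimately show ?case by (simp add: PA)
next
  case (Suc k)
  have k: "2 \<le> k" "k \<le> h - 1" using Suc by auto
  have "(\<Prod>l\<in>{2..<k}. racah_factor \<nu> l * left_node x \<nu> l) * root_node x \<nu> k * (\<Prod>l=k..h - 1. right_node x l)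
      = (\<Sum>s\<le>n - iidx \<nu> k - J k. (\<Prod>l\<in>{2..<Suc k}. racah_factor (\<nu>(k := s)) l * left_node x (\<nu>(k := s)) l)
          * root_node x (\<nu>(k := s)) (Suc k) * (\<Prod>l=Suc k..h - 1. right_node x l))"
    if \<nu>: "\<nu> \<in> partial_admissible k" for \<nu>
  proof -
    define P R where "P = (\<Prod>l\<in>{2..<k}. racah_factor \<nu> l * left_node x \<nu> l)"
      and "R = (\<Prod>l=Suc k..h - 1. right_node x l)"
    have P: "(\<Prod>l\<in>{2..<Suc k}. racah_factor (\<nu>(k := s)) l * left_node x (\<nu>(k := s)) l)
        = P * (racah_factor (\<nu>(k := s)) k * left_node x (\<nu>(k := s)) k)" for s
      using k by (simp add: P_def factor_upd)
    have R: "(\<Prod>l=k..h - 1. right_node x l) = right_node x k * R"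
      using k by (simp add: R_def prod.atLeast_Suc_atMost)
    have eq: "P * R * (root_node x \<nu> k * right_node x k)
      = P * R * (\<Sum>s\<le>n - iidx \<nu> k - J k. racah_factor (\<nu>(k := s)) k * left_node x (\<nu>(k := s)) k * root_node x (\<nu>(k := s)) (Suc k))"
    proof (cases "iidx \<nu> k \<le> psum x (k - 1) \<and> psum x k + J k \<le> psum x h")
      case True
      then show ?thesis
        using rotation[OF k partial_admissible_iidx[OF \<nu>]] k by simp
    next
      case False
      then have "P = 0 \<or> R = 0"
        using prod_left_node_eq_0[of k x \<nu>] prod_right_node_eq_0[of k x] k
        by (auto simp: P_def R_def prod.distrib)
      then show ?thesis by auto
    qed
    have "P * root_node x \<nu> k * (right_node x k * R) = P * R * (root_node x \<nu> k * right_node x k)" by simp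
    also note eq
    also have "P * R * (\<Sum>s\<le>n - iidx \<nu> k - J k. racah_factor (\<nu>(k := s)) k * left_node x (\<nu>(k := s)) k * root_node x (\<nu>(k := s)) (Suc k))
      = (\<Sum>s\<le>n - iidx \<nu> k - J k. P * (racah_factor (\<nu>(k := s)) k * left_node x (\<nu>(k := s)) k)
          * root_node x (\<nu>(k := s)) (Suc k) * R)"
      unfolding sum_distrib_left by (intro sum.cong refl) (simp only: mult_ac)
    finally show ?thesis unfolding P R P_def[symmetric] R_def[symmetric] .
  qed
  then show ?case
    using Suc.IH Suc.prems by (simp add: sum_partial_admissible_Suc[OF k])
qed

lemma iidx_admissible:
  assumes "\<nu> \<in> admissible h n m"
  shows "iidx \<nu> (h + 1) = n" "iidx \<nu> h + \<nu> h = n"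
proof -
  have "{2..<h + 1} = {2..h}" by auto
  then show "iidx \<nu> (h + 1) = n"
    using assms by (simp add: admissible_def compositions_def iidx_def)
  then show "iidx \<nu> h + \<nu> h = n" using iidx_Suc[of h \<nu>] h by simp
qed

theorem xi_expansion:
  assumes x: "x \<in> compositions {1..h} N"
  shows "xi q h \<alpha> m x = (\<Sum>\<nu>\<in>admissible h n m. conn_coeff q h \<alpha> n m \<nu> * theta q h \<alpha> \<nu> x)"
proof -
  have N: "psum x h = N" using x by (simp add: compositions_def psum_def)
  have iv: "{2..<h} = {2..h - 1}" "{2..h} = insert h {2..<h}" using h by auto
  have "xi q h \<alpha> m x = (\<Sum>\<nu>\<in>partial_admissible h.
      (\<Prod>l\<in>{2..<h}. racah_factor \<nu> l * left_node x \<nu> l) * root_node x \<nu> h)"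
    unfolding xi_eq_prod[OF N] using right_comb_expansion[of h x] h by simp
  also have "\<dots> = (\<Sum>\<nu>\<in>admissible h n m. conn_coeff q h \<alpha> n m \<nu> * theta q h \<alpha> \<nu> x)"
  \<comment> \<open>The last degree is not summed over: the total n forces it to be n - i_h, so a
    tuple on {2..<h} extends uniquely to {2..h}.\<close>
  proof (rule sum.reindex_bij_witness[where i = "\<lambda>\<nu>. \<nu>(h := undefined)" and j = "\<lambda>\<nu>. \<nu>(h := n - iidx \<nu> h)"])
    fix \<nu> assume \<nu>: "\<nu> \<in> partial_admissible h"
    have n: "iidx \<nu> h \<le> n" using partial_admissible_iidx[OF \<nu>] h by simp
    have "\<nu> h = undefined" using \<nu> by (auto simp: partial_admissible_def PiE_iff extensional_def)
    then show "(\<nu>(h := n - iidx \<nu> h))(h := undefined) = \<nu>" by (simp add: fun_upd_idem)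
    define \<mu> where "\<mu> = \<nu>(h := n - iidx \<nu> h)"
    have i\<mu>: "iidx \<mu> l = iidx \<nu> l" if "l \<le> h" for l using that by (simp add: \<mu>_def iidx_upd)
    have "(\<Sum>i\<in>{2..h}. \<mu> i) = iidx \<mu> h + \<mu> h"
      unfolding iv(2) by (simp add: iidx_def)
    also have "\<dots> = n" using n i\<mu> by (simp add: \<mu>_def)
    finally show mem: "\<mu> \<in> admissible h n m"
      using \<nu> h unfolding admissible_def compositions_def partial_admissible_def iv(1)
      by (auto simp: PiE_iff extensional_def i\<mu>) (auto simp: \<mu>_def)
    \<comment> \<open>For k = h the right comb is the single leaf h, with J (h-1) = 0 and A_h /
      A_(h-1) = \<alpha> h, so the root is the last node of the left comb.\<close>
    have "root_node x \<nu> h = left_node x \<mu> h"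
    proof -
      have "psum x h = psum x (h - 1) + x h" using psum_Suc[of x "h - 1"] h by simp
      moreover have "A h / A (h - 1) = \<alpha> h" using A_step[of h] A_pos[of "h - 1"] h by simp
      ultimately show ?thesis
        unfolding root_node_def left_node_def i\<mu>[OF order_refl] by (simp add: \<mu>_def)
    qed
    moreover have "theta q h \<alpha> \<mu> x = left_node x \<mu> h * (\<Prod>l\<in>{2..<h}. left_node x \<nu> l)"
    proof -
      have "(\<Prod>l\<in>{2..<h}. left_node x \<mu> l) = (\<Prod>l\<in>{2..<h}. left_node x \<nu> l)"
        by (intro prod.cong) (auto simp: \<mu>_def factor_upd)
      then show ?thesis
        unfolding theta_eq_prod[OF N iidx_admissible(1)[OF mem]] iv(2) by simp
    qed
    moreover have "conn_coeff q h \<alpha> n m \<mu> = (\<Prod>l\<in>{2..<h}. racah_factor \<nu> l)"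
      unfolding conn_coeff_def iv(1)[symmetric] racah_factor_def[symmetric]
      by (intro prod.cong) (auto simp: \<mu>_def factor_upd)
    ultimately show "conn_coeff q h \<alpha> n m \<mu> * theta q h \<alpha> \<mu> x
        = (\<Prod>l\<in>{2..<h}. racah_factor \<nu> l * left_node x \<nu> l) * root_node x \<nu> h"
      by (simp add: prod.distrib)
  next
    fix \<nu> assume \<nu>: "\<nu> \<in> admissible h n m"
    show "(\<nu>(h := undefined))(h := n - iidx (\<nu>(h := undefined)) h) = \<nu>"
      using iidx_admissible(2)[OF \<nu>] by (simp add: iidx_upd fun_upd_idem)
    have und: "\<nu> l = undefined" if "l \<notin> {2..h}" for l
      using \<nu> that by (auto simp: admissible_def compositions_def PiE_iff extensional_def)
    show "\<nu>(h := undefined) \<in> partial_admissible h"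
      using \<nu> unfolding admissible_def compositions_def partial_admissible_def iv(1)
      by (auto simp: PiE_iff extensional_def iidx_upd) (rule und, use h in auto)
  qed
  finally show ?thesis .
qed

section \<open>The Gasper--Rahman polynomials\<close>

lemma psum_m:
  assumes "k \<le> h - 1"
  shows "psum m k + J k = n"
proof -
  have "{1..h - 1} = {1..k} \<union> {k + 1..h - 1}" using assms by auto
  then show ?thesis
    unfolding psum_def jidx_def m[symmetric] by (simp only:) (subst sum.union_disjoint, auto)
qed

text \<open>Both sides sum m_l times the k-th degree over k < l. Factor by factor, the Gasper-Rahman
  normalization and the connection coefficient differ by q^(m_k i_k - J_k \<nu>_k); only in the full
  product do these powers cancel.\<close>

lemma sum_J_mult: "(\<Sum>k=2..h - 1. J k * \<nu> k) = (\<Sum>k=2..h - 1. m k * iidx \<nu> k)"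
proof -
  have J: "J k = (\<Sum>l=2..h - 1. if k < l then m l else 0)" if "2 \<le> k" for k
    unfolding jidx_def using that by (intro sum.mono_neutral_cong_left) auto
  have I: "iidx \<nu> l = (\<Sum>k=2..h - 1. if k < l then \<nu> k else 0)" if "l \<le> h - 1" for l
    unfolding iidx_def using that by (intro sum.mono_neutral_cong_left) auto
  have "(\<Sum>k=2..h - 1. J k * \<nu> k) = (\<Sum>k=2..h - 1. \<Sum>l=2..h - 1. if k < l then m l * \<nu> k else 0)"
    by (intro sum.cong refl) (auto simp: J sum_distrib_right intro!: sum.cong)
  also have "\<dots> = (\<Sum>l=2..h - 1. \<Sum>k=2..h - 1. if k < l then m l * \<nu> k else 0)"
    by (rule sum.swap)
  also have "\<dots> = (\<Sum>l=2..h - 1. m l * iidx \<nu> l)"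
    by (intro sum.cong refl) (auto simp: I sum_distrib_left intro!: sum.cong)
  finally show ?thesis .
qed

definition GR_parameter :: "nat \<Rightarrow> real" where
  "GR_parameter k = (if k = 1 then (\<Prod>i=2..h. inverse (\<alpha> i)) * q powi (- 2 * int n - int h + 2) else \<alpha> k * q)"

lemma GR_parameter_1: "GR_parameter 1 = \<alpha> 1 / A h * q powi (- 2 * int n - int h + 2)"
proof -
  have "A h = \<alpha> 1 * (\<Prod>i=2..h. \<alpha> i)"
    unfolding pprod_def using h by (subst prod.atLeast_Suc_atMost) (auto simp: numeral_2_eq_2)
  moreover have "\<alpha> 1 \<noteq> 0" using \<alpha>_pos[of 1] h by simp
  moreover have "(\<Prod>i=2..h. inverse (\<alpha> i)) = inverse (\<Prod>i=2..h. \<alpha> i)"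
    using prod_dividef[of "\<lambda>_. 1" \<alpha> "{2..h}"] by (simp add: divide_inverse)
  ultimately show ?thesis
    by (simp add: GR_parameter_def divide_inverse)
qed

text \<open>In the Gasper-Rahman polynomials the products of the a's occur divided by a_1 and
  multiplied by b, or inverted. The first form becomes A_(k-1) q^(k-2); the second brings in A_h
  through a_1.\<close>

lemma pprod_GR_parameter:
  assumes "2 \<le> k"
  shows "\<alpha> 1 * pprod GR_parameter (k - 1) = GR_parameter 1 * A (k - 1) * q ^ (k - 2)"
  using assms
proof (induction k rule: nat_induct_at_least)
  case base
  then show ?case by (simp add: pprod_def)
next
  case (Suc k)
  have "k - 1 = (k - 2) + 1" using Suc.hyps by simp
  then have e: "q ^ (k - 1) = q ^ (k - 2) * q"
    by (metis power_add power_one_right)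
  have "pprod GR_parameter k = pprod GR_parameter (k - 1) * (\<alpha> k * q)" "A k = A (k - 1) * \<alpha> k"
    using Suc.hyps pprod_Suc[of _ "k - 1"] by (simp_all add: GR_parameter_def)
  then have "\<alpha> 1 * pprod GR_parameter k = (\<alpha> 1 * pprod GR_parameter (k - 1)) * (\<alpha> k * q)" by simp
  also have "\<dots> = GR_parameter 1 * A k * q ^ (k - 1)"
    unfolding Suc.IH e using \<open>A k = _\<close> by simp
  finally show ?case using Suc.hyps by (simp add: numeral_2_eq_2)
qed

text \<open>The m-independent part of the normalization of one factor.\<close>

definition GR_norm :: "(nat \<Rightarrow> nat) \<Rightarrow> nat \<Rightarrow> real" where
  "GR_norm \<nu> k = (qpoch (A k * q ^ (2 * iidx \<nu> k + \<nu> k + k - 1)) q (\<nu> k)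
                * qpoch (\<alpha> k * q) q (\<nu> k) * qpoch q q (\<nu> k))
              / (A h / A (k - 1) * q powi (int (\<nu> k) + int h - int k + 1)) powr (real (\<nu> k) / 2)"

lemma q_racah_GR_factor:
  assumes \<nu>: "\<nu> \<in> admissible h n m" and k: "2 \<le> k" "k \<le> h - 1"
  shows "q_racah_GR q (\<nu> k) (psum m k - psum m (k - 1)) (GR_parameter k / q)
      (\<alpha> 1 * pprod GR_parameter (k - 1) * q ^ (2 * iidx \<nu> k) / GR_parameter 1)
      (1 / pprod GR_parameter (k - 1) * q powi (- int (psum m k) - int (iidx \<nu> k)))
      (psum m k - iidx \<nu> k)
    = (-1) ^ \<nu> k * GR_norm \<nu> k * (racah_factor \<nu> k * (q ^ (m k * iidx \<nu> k) / q ^ (J k * \<nu> k)))"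
proof -
  define i j where "i = iidx \<nu> k" and "j = J k"
  have kh: "k \<le> h" "k - 1 \<le> h" using k by linarith+
  have Ap: "0 < A k" "0 < A (k - 1)" "0 < A h" using A_pos kh by auto
  have a0: "0 < \<alpha> 1" "0 < \<alpha> k" using \<alpha>_pos h k kh by auto
  have adm: "\<nu> k + i + j \<le> n" using \<nu> k by (auto simp: admissible_def i_def j_def)
  have pm: "psum m k + j = n" using psum_m k by (simp add: j_def)
  have x: "psum m k - psum m (k - 1) = m k" using psum_Suc[of m "k - 1"] k by simp
  have M: "psum m k - i = n - i - j" using pm by simp
  have p1: "GR_parameter k / q = \<alpha> k" using k by (simp add: GR_parameter_def)
  have g0: "GR_parameter 1 \<noteq> 0" unfolding GR_parameter_1 using a0 Ap by simp
  have pe: "q powi (2 * int i + int k - 2) = q ^ (k - 2) * q ^ (2 * i)"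
    unfolding power_add[symmetric] by (rule powi_eq_power) (use k in simp)
  have p2: "\<alpha> 1 * pprod GR_parameter (k - 1) * q ^ (2 * i) / GR_parameter 1
      = A (k - 1) * q powi (2 * int i + int k - 2)"
    unfolding pprod_GR_parameter[OF k(1)] pe using g0 by simp
  have "pprod GR_parameter (k - 1) = GR_parameter 1 * A (k - 1) * q ^ (k - 2) / \<alpha> 1"
    using pprod_GR_parameter[OF k(1)] a0 by (simp add: field_simps)
  also have "\<dots> = A (k - 1) / A h * (q powi (- 2 * int n - int h + 2) * q powi int (k - 2))"
    unfolding GR_parameter_1 using a0 by simp
  also have "\<dots> = A (k - 1) / A h * q powi (- (2 * int n + int h - int k))"
  proof -
    have "(- 2 * int n - int h + 2) + int (k - 2) = - (2 * int n + int h - int k)" using k by simp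
    then show ?thesis by (metis power_int_add q0)
  qed
  finally have pp: "1 / pprod GR_parameter (k - 1) = A h / A (k - 1) * q powi (2 * int n + int h - int k)"
    by (simp only: power_int_minus divide_inverse inverse_mult_distrib inverse_inverse_eq mult_1_left mult_ac)
  have p3: "1 / pprod GR_parameter (k - 1) * q powi (- int (psum m k) - int i)
      = A h / A (k - 1) * q powi (int n + int j - int i + int h - int k)"
  proof -
    have "int n + int j - int i + int h - int k = (2 * int n + int h - int k) + (- int (psum m k) - int i)"
      using pm by simp
    then have "q powi (int n + int j - int i + int h - int k)
        = q powi (2 * int n + int h - int k) * q powi (- int (psum m k) - int i)"
      by (simp only: power_int_add q0 not_False_eq_True simp_thms)
    then show ?thesis unfolding pp by simp
  qed
  define B where "B = A h / A (k - 1) * q powi (int (\<nu> k) + int h - int k + 1)"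
  have B: "0 < B" using Ap q by (simp add: B_def)
  \<comment> \<open>The base of the half-integer power depends on m only through q^(2j); taken to
    the power \<nu> k / 2 this is the integer power q^(j \<nu>_k), which can be split off.\<close>
  have p4: "q powi (- int (n - i - j) + int (\<nu> k) + 1) * (A h / A (k - 1) * q powi (int n + int j - int i + int h - int k))
      = B * q ^ (2 * j)"
  proof -
    have "(- int (n - i - j) + int (\<nu> k) + 1) + (int n + int j - int i + int h - int k)
        = (int (\<nu> k) + int h - int k + 1) + int (2 * j)"
      using adm by simp
    then have "q powi (- int (n - i - j) + int (\<nu> k) + 1) * q powi (int n + int j - int i + int h - int k)
        = q powi (int (\<nu> k) + int h - int k + 1) * q ^ (2 * j)"
      by (simp only: power_int_add[symmetric] power_int_of_nat[symmetric] q0 not_False_eq_True simp_thms)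
    then show ?thesis by (simp add: B_def)
  qed
  have p5: "(B * q ^ (2 * j)) powr (real (\<nu> k) / 2) = B powr (real (\<nu> k) / 2) * q ^ (j * \<nu> k)"
  proof -
    have "(q ^ (2 * j)) powr (real (\<nu> k) / 2) = q powr (real (2 * j) * (real (\<nu> k) / 2))"
      using q by (simp only: powr_realpow[symmetric] powr_powr)
    also have "real (2 * j) * (real (\<nu> k) / 2) = real (j * \<nu> k)" by simp
    also have "q powr real (j * \<nu> k) = q ^ (j * \<nu> k)" by (rule powr_realpow[OF q(1)])
    finally show ?thesis using B q by (simp add: powr_mult)
  qed
  have p6: "\<alpha> k * (A (k - 1) * q powi (2 * int i + int k - 2)) * q ^ (\<nu> k + 1) = A k * q ^ (2 * i + \<nu> k + k - 1)"
  proof -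
    have "2 * i + \<nu> k + k - 1 = (k - 2) + 2 * i + (\<nu> k + 1)" using k by simp
    then have "q ^ (2 * i + \<nu> k + k - 1) = q ^ (k - 2) * q ^ (2 * i) * q ^ (\<nu> k + 1)"
      by (simp only: power_add)
    then show ?thesis unfolding pe A_step[OF k(1)] by (simp only: mult_ac)
  qed
  have "q ^ (m k * i) * q powi (- int (m k * i)) = 1" by (simp add: power_int_minus flip: of_nat_mult)
  then have rf: "racah_factor \<nu> k * (q ^ (m k * i) / q ^ (j * \<nu> k))
      = q_racah q (\<nu> k) (m k) (\<alpha> k) (A (k - 1) * q powi (2 * int i + int k - 2))
          (A h / A (k - 1) * q powi (int n + int j - int i + int h - int k)) (n - i - j) / q ^ (j * \<nu> k)"
    unfolding racah_factor_def i_def[symmetric] j_def[symmetric] by (simp add: mult_ac)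
  show ?thesis
    unfolding i_def[symmetric] j_def[symmetric] x M p1 p2 p3 rf
    unfolding q_racah_GR_def p4 p5 p6 GR_norm_def B_def[symmetric] i_def[symmetric]
    by simp
qed

theorem multi_q_racah_eq:
  assumes \<nu>: "\<nu> \<in> admissible h n m"
  shows "multi_q_racah q (h - 2) (\<lambda>k. \<nu> (k + 1)) (\<lambda>k. psum m k) GR_parameter (\<alpha> 1) n
    = (-1) ^ (\<Sum>k=2..h-1. \<nu> k) * (\<Prod>k=2..h-1. GR_norm \<nu> k) * conn_coeff q h \<alpha> n m \<nu>"
proof -
  \<comment> \<open>The convention that the variable after the last one equals n agrees with the
    partial sums of m, since m_1 + ... + m_(h-1) = n; so y_k is a partial sum up to k = h -
    1.\<close>
  define y where "y = (\<lambda>k. psum m k)(h - 2 + 1 := n)"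
  have y: "y k = psum m k" if "k \<le> h - 1" for k
  proof -
    have "h - 2 + 1 = h - 1" using h by simp
    then show ?thesis using psum_m[of "h - 1"] that by (simp add: y_def)
  qed
  define g where "g k = (-1) ^ \<nu> k * GR_norm \<nu> k * (racah_factor \<nu> k * (q ^ (m k * iidx \<nu> k) / q ^ (J k * \<nu> k)))" for k
  have i: "psum (\<lambda>k. \<nu> (k + 1)) (k - 1) = iidx \<nu> (Suc k)" if "1 \<le> k" for k
  proof -
    have "iidx \<nu> (Suc k) = (\<Sum>i=Suc 1..<Suc k. \<nu> i)" by (simp add: iidx_def numeral_2_eq_2)
    also have "\<dots> = (\<Sum>i=1..<k. \<nu> (Suc i))" by (rule sum.shift_bounds_Suc_ivl)
    also have "{1..<k} = {1..k - 1}" using that by auto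
    finally show ?thesis by (simp add: psum_def)
  qed
  have "multi_q_racah q (h - 2) (\<lambda>k. \<nu> (k + 1)) (\<lambda>k. psum m k) GR_parameter (\<alpha> 1) n = (\<Prod>k=1..h - 2. g (Suc k))"
    unfolding multi_q_racah_def Let_def y_def[symmetric]
  proof (intro prod.cong refl)
    fix k assume "k \<in> {1..h - 2}"
    then have k: "1 \<le> k" "2 \<le> Suc k" "Suc k \<le> h - 1" "k \<le> h - 1" by auto
    show "q_racah_GR q (\<nu> (k + 1)) (y (k + 1) - y k) (GR_parameter (k + 1) / q)
          (\<alpha> 1 * pprod GR_parameter k * q ^ (2 * psum (\<lambda>k. \<nu> (k + 1)) (k - 1)) / GR_parameter 1)
          (1 / pprod GR_parameter k * q powi (- int (y (k + 1)) - int (psum (\<lambda>k. \<nu> (k + 1)) (k - 1))))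
          (y (k + 1) - psum (\<lambda>k. \<nu> (k + 1)) (k - 1)) = g (Suc k)"
      using q_racah_GR_factor[OF \<nu> k(2,3)] unfolding i[OF k(1)] unfolding y[OF k(4)] Suc_eq_plus1[symmetric] y[OF k(3)] g_def
      by (simp only: diff_Suc_1)
  qed
  \<comment> \<open>The Gasper-Rahman factor with index k is the comb factor with index k +
    1.\<close>
  also have "\<dots> = (\<Prod>k=Suc 1..Suc (h - 2). g k)"
    by (rule prod.shift_bounds_cl_Suc_ivl[symmetric])
  also have "{Suc 1..Suc (h - 2)} = {2..h - 1}" using h by auto
  also have "(\<Prod>k=2..h - 1. g k) = (-1) ^ (\<Sum>k=2..h-1. \<nu> k) * (\<Prod>k=2..h-1. GR_norm \<nu> k)
      * ((\<Prod>k=2..h-1. racah_factor \<nu> k) * (q ^ (\<Sum>k=2..h - 1. m k * iidx \<nu> k) / q ^ (\<Sum>k=2..h - 1. J k * \<nu> k)))"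
    by (simp add: g_def prod.distrib prod_dividef power_sum)
  also have "\<dots> = (-1) ^ (\<Sum>k=2..h-1. \<nu> k) * (\<Prod>k=2..h-1. GR_norm \<nu> k) * conn_coeff q h \<alpha> n m \<nu>"
    unfolding sum_J_mult by (simp add: conn_coeff_def racah_factor_def)
  finally show ?thesis .
qed

end

theorem mainTheorem6:
  fixes q :: real and h N n :: nat and \<alpha> :: "nat \<Rightarrow> real" and m :: "nat \<Rightarrow> nat"
  assumes "0 < q" and "q < 1"
    and "h \<ge> 3" and "N \<ge> 1" and "n \<le> N"
    and "(\<forall>i\<in>{1..h}. 0 < \<alpha> i \<and> \<alpha> i < 1 / q) \<or> (\<forall>i\<in>{1..h}. \<alpha> i > 1 / q ^ N)"
    and "(\<Sum>k=1..h-1. m k) = n"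
  shows "(\<forall>x\<in>compositions {1..h} N.
            xi q h \<alpha> m x = (\<Sum>\<nu>\<in>admissible h n m. conn_coeff q h \<alpha> n m \<nu> * theta q h \<alpha> \<nu> x))
    \<and> (\<forall>\<nu>\<in>admissible h n m.
         multi_q_racah q (h - 2) (\<lambda>k. \<nu> (k + 1)) (\<lambda>k. psum m k)
           (\<lambda>k. if k = 1 then (\<Prod>i=2..h. inverse (\<alpha> i)) * q powi (- 2 * int n - int h + 2)
                else \<alpha> k * q)
           (\<alpha> 1) n
         = (-1) ^ (\<Sum>k=2..h-1. \<nu> k) *
           (\<Prod>k=2..h-1.
              (qpoch (pprod \<alpha> k * q ^ (2 * iidx \<nu> k + \<nu> k + k - 1)) q (\<nu> k)
                * qpoch (\<alpha> k * q) q (\<nu> k) * qpoch q q (\<nu> k))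
              / (pprod \<alpha> h / pprod \<alpha> (k - 1) * q powi (int (\<nu> k) + int h - int k + 1))
                  powr (real (\<nu> k) / 2))
           * conn_coeff q h \<alpha> n m \<nu>)"
proof -
  interpret hahn_combs q h N n \<alpha> m by (rule hahn_combs.intro) (fact assms)+
  show ?thesis
    using xi_expansion multi_q_racah_eq
    unfolding GR_norm_def GR_parameter_def[abs_def] by blast
qed

end
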